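(* The following inequalities hold: $$\frac{7}{3}\leq e_r^*(5)\leq 3,\qquad \frac{17}{5}\leq e_r^*(7)\leq 5,\qquad \frac{31}{7}\leq e_r^*(9)\leq 7.$$
   Context: All polynomials have integer coefficients. For an integer polynomial $P(x)$ of degree $d\ge 2$, let $\mathrm{H}(P)$ denote its naïve height, i.e. the maximum of the absolute values of its coefficients. If $P$ has at least two distinct complex roots, its root separation is $$\mathrm{sep}(P):=\min_{\substack{P(\alpha)=P(\beta)=0,\\ \alpha\neq\beta}}|\alpha-\beta|,$$ where the minimum is over pairs of distinct complex roots of $P$. The quantity $e(P)$ is defined (when $\mathrm{H}(P)>1$) by $\mathrm{sep}(P)=\mathrm{H}(P)^{-e(P)}$, that is, $e(P)=-\log \mathrm{sep}(P)/\log \mathrm{H}(P)$. For $d\ge 2$, set $$e_r^*(d):=\limsup_{\deg(P)=d,\ \mathrm{H}(P)\to+\infty} e(P)=\lim_{H\to+\infty}\ \sup\{e(P): \deg P=d,\ \mathrm{H}(P)\ge H\},$$ where $P$ ranges over the monic integer polynomials of degree $d$ that are reducible over $\mathbb{Q}$ and have at least two distinct complex roots (the roots are not required to be simple). *)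

theory Defs
  imports Complex_Main "HOL-Library.Extended_Real" "HOL-Library.Liminf_Limsup"
    "HOL-Computational_Algebra.Computational_Algebra"
begin

definition height :: "int poly \<Rightarrow> int" where
  "height P = Max {\<bar>coeff P i\<bar> | i. i \<le> degree P}"

definition complex_roots :: "int poly \<Rightarrow> complex set" where
  "complex_roots P = {z. poly (map_poly of_int P) z = 0}"

(* Only meaningful when P is nonzero and has at least two distinct complex roots. *)
definition root_sep :: "int poly \<Rightarrow> real" where
  "root_sep P = Min {cmod (\<alpha> - \<beta>) | \<alpha> \<beta>.
     \<alpha> \<in> complex_roots P \<and> \<beta> \<in> complex_roots P \<and> \<alpha> \<noteq> \<beta>}"

(* Only meaningful when the height of P exceeds 1. *)
definition sep_exponent :: "int poly \<Rightarrow> real" where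
  "sep_exponent P = - ln (root_sep P) / ln (real_of_int (height P))"

(* For degree at least 2 the image of P in the rational polynomials is neither zero nor a unit,
   so failing to be irreducible there is exactly being reducible over the rationals. *)
definition monic_reducible_polys :: "nat \<Rightarrow> int poly set" where
  "monic_reducible_polys d =
     {P. degree P = d \<and> lead_coeff P = 1 \<and>
         \<not> irreducible (map_poly of_int P :: rat poly) \<and>
         (\<exists>\<alpha>\<in>complex_roots P. \<exists>\<beta>\<in>complex_roots P. \<alpha> \<noteq> \<beta>)}"

(* The filter describes P ranging over monic_reducible_polys d with height tending to infinity.
   The limsup is taken in the extended reals, so finiteness is not presupposed. *)
definition e_r_star :: "nat \<Rightarrow> ereal" where
  "e_r_star d =
     Limsup (inf (filtercomap height at_top) (principal (monic_reducible_polys d)))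
       (\<lambda>P. ereal (sep_exponent P))"

lemma e_r_star_eq_INF:
  "e_r_star d = (INF H. SUP P \<in> {P \<in> monic_reducible_polys d. height P \<ge> H}.
                    ereal (sep_exponent P))"
proof (rule antisym)
  let ?F = "inf (filtercomap height at_top) (principal (monic_reducible_polys d))"
  let ?S = "\<lambda>H. {P \<in> monic_reducible_polys d. height P \<ge> H}"
  have ev: "eventually (\<lambda>P. P \<in> ?S H) ?F" for H
    unfolding eventually_inf_principal eventually_filtercomap
    by (rule exI[of _ "\<lambda>n. n \<ge> H"]) (auto simp: eventually_ge_at_top)
  show "e_r_star d \<le> (INF H. SUP P\<in>?S H. ereal (sep_exponent P))"
    unfolding e_r_star_def Limsup_def
  proof (rule INF_greatest)
    fix H
    show "(INF Q\<in>{Q. eventually Q ?F}. SUP P\<in>Collect Q. ereal (sep_exponent P))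
            \<le> (SUP P\<in>?S H. ereal (sep_exponent P))"
      by (rule INF_lower2[where i = "\<lambda>P. P \<in> ?S H"]) (use ev[of H] in auto)
  qed
  show "(INF H. SUP P\<in>?S H. ereal (sep_exponent P)) \<le> e_r_star d"
    unfolding e_r_star_def Limsup_def
  proof (rule INF_greatest)
    fix Q assume "Q \<in> {Q. eventually Q ?F}"
    then obtain H where H: "\<And>P. P \<in> ?S H \<Longrightarrow> Q P"
      unfolding eventually_inf_principal eventually_filtercomap eventually_at_top_linorder
      by auto
    show "(INF H. SUP P\<in>?S H. ereal (sep_exponent P)) \<le> (SUP P\<in>Collect Q. ereal (sep_exponent P))"
      by (rule INF_lower2[where i = H]) (use H in \<open>auto intro!: SUP_subset_mono\<close>)
  qed
qed

lemma e_r_star_tendsto: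
  "((\<lambda>H. SUP P \<in> {P \<in> monic_reducible_polys d. height P \<ge> H}.
        ereal (sep_exponent P)) \<longlongrightarrow> e_r_star d) at_top"
  (is "(?s \<longlongrightarrow> _) _")
proof (rule decreasing_tendsto)
  show "\<forall>\<^sub>F H in at_top. e_r_star d \<le> ?s H"
    unfolding e_r_star_eq_INF by (intro always_eventually allI INF_lower) simp
next
  fix x assume "e_r_star d < x"
  then obtain H where H: "?s H < x"
    unfolding e_r_star_eq_INF INF_less_iff by auto
  have "?s H' \<le> ?s H" if "H' \<ge> H" for H'
    by (rule SUP_subset_mono) (use that in auto)
  with H show "\<forall>\<^sub>F H in at_top. ?s H < x"
    unfolding eventually_at_top_linorder by (meson order.strict_trans1)
qed

end

theory Submission
  imports Defs "Jordan_Normal_Form.Determinant" "Berlekamp_Zassenhaus.Factor_Bound"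
    "HOL-Real_Asymp.Real_Asymp"
begin

text \<open>
  Upper bounds: if \<open>f\<close> and \<open>g\<close> are the minimal polynomials of the two closest roots \<open>\<alpha>\<close>, \<open>\<beta>\<close>
  of \<open>P\<close>, the product of all differences of a root of \<open>f\<close> and a (distinct) root of \<open>g\<close> is a
  nonzero integer, and every difference is at most \<open>2 max(1, |a|) max(1, |b|)\<close>. Hence \<open>|\<alpha> - \<beta>|\<close> is
  bounded below in terms of Mahler measures, and these are bounded by the height of \<open>P\<close>
  (Landau). Reducibility of \<open>P\<close> makes the exponent \<open>d - 2\<close> instead of Mahler's \<open>d - 1\<close>.

  Lower bounds: for \<open>d = 2 n + 1\<close> and \<open>t = y + 1/y\<close> let \<open>\<beta> = y^(n-1) + y^n\<close>, a root of a monic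
  quadratic polynomial \<open>R\<close> with coefficients of size \<open>t^n\<close>. There is a monic polynomial \<open>Q\<close> of degree
  \<open>2 n - 1\<close> with coefficients of size \<open>t^(n-1)\<close> such that \<open>Q(\<beta>) = y^(n (2 n - 1))\<close>, a tiny unit;
  comparing powers of \<open>y\<close> turns this into linear equations, whose solutions for \<open>n = 2, 3, 4\<close> are
  integral. As \<open>|Q'(\<beta>)|\<close> has order \<open>t^(n-1)\<close>, some root of \<open>Q\<close> has distance of order
  \<open>t^(1 - 2 n^2)\<close> to \<open>\<beta>\<close>, while \<open>R Q\<close> has height of order \<open>t^(2 n - 1)\<close>. This gives the exponent
  \<open>(2 n^2 - 1) / (2 n - 1)\<close>.
\<close>

hide_const (open) up_ring.coeff up_ring.monom module.smult Mahler_Measure.height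

section \<open>Upper bounds\<close>

lemma eq_0_if_poly_eq_0_at_distinct:
  fixes p :: "'a :: idom poly"
  assumes "distinct as" "\<And>a. a \<in> set as \<Longrightarrow> poly p a = 0" "p = 0 \<or> degree p < length as"
  shows "p = 0"
proof (rule ccontr)
  assume p: "p \<noteq> 0"
  have "card (set as) \<le> card {x. poly p x = 0}"
    using assms(2) by (intro card_mono poly_roots_finite p) auto
  also have "\<dots> \<le> degree p" by (rule card_poly_roots_bound[OF p])
  finally show False using assms(1,3) p by (simp add: distinct_card)
qed

text \<open>With \<open>V\<close> the Vandermonde matrix of the roots, multiplication by \<open>g\<close> modulo \<open>f\<close> has an integer
  matrix \<open>C\<close> satisfying \<open>diag (g a) V = V C\<close>, hence the product is \<open>det C\<close>.\<close>

lemma prod_poly_roots_in_Ints: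
  fixes f g :: "int poly"
  assumes monic: "lead_coeff f = 1" and dist: "distinct as" and len: "length as = degree f"
    and roots: "\<And>a. a \<in> set as \<Longrightarrow> poly (map_poly of_int f) (a :: complex) = 0"
  shows "(\<Prod>a\<leftarrow>as. poly (map_poly of_int g) a) \<in> \<int>"
proof -
  define n where "n = degree f"
  have f0: "f \<noteq> 0" using monic by auto
  let ?c = "map_poly of_int :: int poly \<Rightarrow> complex poly"
  \<comment> \<open>The remainders of \<open>g * x^j\<close> modulo \<open>f\<close> give the
    columns of \<open>C\<close>. Since \<open>f\<close> is monic, pseudo-division is genuine
    division over the integers.\<close>
  define r where "r j = snd (pseudo_divmod (g * monom 1 j) f)" for j
  have r: "g * monom 1 j = f * fst (pseudo_divmod (g * monom 1 j) f) + r j"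
    "r j = 0 \<or> degree (r j) < n" for j
    using pseudo_divmod[OF f0, of "g * monom 1 j", OF prod.collapse[symmetric]] monic
    unfolding r_def n_def by auto
  have rv: "poly (?c g) a * a ^ j = (\<Sum>k<n. a ^ k * of_int (coeff (r j) k))" if a: "a \<in> set as" for a j
  proof -
    have "poly (?c g) a * a ^ j = poly (?c (g * monom 1 j)) a"
      by (simp add: of_int_poly_hom.hom_mult poly_monom map_poly_monom)
    also have "\<dots> = poly (?c (r j)) a"
      by (subst r(1)) (simp add: of_int_poly_hom.hom_mult of_int_poly_hom.hom_add roots[OF a])
    also have "\<dots> = (\<Sum>k<n. a ^ k * of_int (coeff (r j) k))"
    proof -
      have "poly (?c (r j)) a = (\<Sum>k\<le>degree (r j). of_int (coeff (r j) k) * a ^ k)"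
        by (simp add: poly_altdef)
      also have "\<dots> = (\<Sum>k<n. of_int (coeff (r j) k) * a ^ k)"
      proof (cases "r j = 0")
        case False
        then have "degree (r j) < n" using r(2)[of j] by auto
        then show ?thesis
          by (intro sum.mono_neutral_left) (auto simp: coeff_eq_0)
      qed simp
      finally show ?thesis by (simp add: mult.commute)
    qed
    finally show ?thesis .
  qed
  define V where "V = mat n n (\<lambda>(i, j). (as ! i) ^ j)"
  define D where "D = mat n n (\<lambda>(i, j). if i = j then poly (?c g) (as ! i) else 0)"
  define C where "C = mat n n (\<lambda>(k, j). coeff (r j) k)"
  have car: "V \<in> carrier_mat n n" "D \<in> carrier_mat n n" "C \<in> carrier_mat n n"
    "map_mat complex_of_int C \<in> carrier_mat n n"
    unfolding V_def D_def C_def by auto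
  have "D * V = V * map_mat complex_of_int C"
  proof (rule eq_matI)
    fix i j assume "i < dim_row (V * map_mat complex_of_int C)" "j < dim_col (V * map_mat complex_of_int C)"
    then have ij: "i < n" "j < n" using car by auto
    have "(D * V) $$ (i, j) = (\<Sum>k<n. (if i = k then poly (?c g) (as ! i) else 0) * (as ! k) ^ j)"
      using ij by (simp add: D_def V_def scalar_prod_def atLeast0LessThan)
    also have "\<dots> = (\<Sum>k<n. if k = i then poly (?c g) (as ! i) * (as ! i) ^ j else 0)"
      by (rule sum.cong) auto
    also have "\<dots> = poly (?c g) (as ! i) * (as ! i) ^ j" using ij by simp
    also have "\<dots> = (\<Sum>k<n. (as ! i) ^ k * of_int (coeff (r j) k))"
      using ij len by (intro rv) (simp add: n_def)
    also have "\<dots> = (V * map_mat complex_of_int C) $$ (i, j)"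
      using ij by (simp add: C_def V_def scalar_prod_def atLeast0LessThan)
    finally show "(D * V) $$ (i, j) = (V * map_mat complex_of_int C) $$ (i, j)" .
  qed (use car in auto)
  then have "det D * det V = det V * det (map_mat complex_of_int C)"
    using det_mult[OF car(2,1)] det_mult[OF car(1,4)] by metis
  \<comment> \<open>A kernel vector of \<open>V\<close> lists the coefficients of a polynomial of
    degree below \<open>n\<close> that vanishes at \<open>n\<close> distinct points.\<close>
  moreover have "det V \<noteq> 0"
  proof
    assume "det V = 0"
    then obtain v where v: "v \<in> carrier_vec n" "v \<noteq> 0\<^sub>v n" "V *\<^sub>v v = 0\<^sub>v n"
      using det_0_iff_vec_prod_zero[OF car(1)] by auto
    define p where "p = (\<Sum>j<n. monom (v $ j) j)"
    have co: "coeff p j = (if j < n then v $ j else 0)" for j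
      unfolding p_def coeff_sum coeff_monom by simp
    have "degree p < n \<or> p = 0"
    proof (cases "p = 0")
      case False
      then have "coeff p (degree p) \<noteq> 0" by simp
      then show ?thesis unfolding co by (auto split: if_splits)
    qed simp
    moreover have "poly p a = 0" if "a \<in> set as" for a
    proof -
      from that obtain i where i: "i < n" "a = as ! i" using len n_def by (auto simp: in_set_conv_nth)
      have "(V *\<^sub>v v) $ i = 0" using v(3) i by simp
      then show ?thesis using i v(1)
        by (simp add: V_def p_def scalar_prod_def poly_sum poly_monom atLeast0LessThan mult.commute)
    qed
    ultimately have "p = 0"
      using eq_0_if_poly_eq_0_at_distinct[OF dist, of p] len n_def by auto
    then have "v = 0\<^sub>v n" using co v(1) by (intro eq_vecI) (auto split: if_splits, metis coeff_0)
    then show False using v by simp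
  qed
  ultimately have "det D = det (map_mat complex_of_int C)" by (metis mult.commute mult_cancel_left)
  also have "\<dots> = of_int (det C)" by (rule of_int_hom.hom_det)
  finally have "det D \<in> \<int>" by simp
  moreover have "det D = prod_list (diag_mat D)"
    by (rule det_upper_triangular[OF _ car(2)]) (auto simp: D_def)
  moreover have "diag_mat D = map (poly (?c g)) as"
    using len unfolding diag_mat_def D_def n_def by (intro nth_equalityI) auto
  ultimately show ?thesis by simp
qed

section \<open>Irreducible polynomials with a common root\<close>

text \<open>Otherwise \<open>p\<close> and \<open>q\<close> are coprime, and evaluating a Bezout
  identity at the common root \<open>a\<close> yields 0 = 1.\<close>

lemma irreducible_rat_dvd_if_common_root:
  fixes p q :: "rat poly"
  assumes irr: "irreducible p" and "poly (map_poly of_rat p) (a :: complex) = 0"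
    and "poly (map_poly of_rat q) a = 0"
  shows "p dvd q"
proof (rule ccontr)
  assume "\<not> p dvd q"
  then have "coprime p q" using irr by (simp add: prime_elem_imp_coprime)
  then obtain u v where "u * p + v * q = 1"
    using bezout_coefficients_fst_snd[of p q] by (auto simp: coprime_iff_gcd_eq_1)
  then have "map_poly of_rat (u * p + v * q) = (1 :: complex poly)" by simp
  then have *: "poly (map_poly of_rat (u * p + v * q)) a = 1" by simp
  interpret hom: map_poly_comm_ring_hom "of_rat :: rat \<Rightarrow> complex"
    by unfold_locales (simp_all add: of_rat_add of_rat_mult)
  show False using * assms by (simp add: hom.hom_add hom.hom_mult)
qed

text \<open>Gauss's lemma: a nonconstant irreducible integer polynomial is primitive, and so stays
  irreducible over the rationals.\<close>

lemma monic_irreducible_rat: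
  fixes f :: "int poly"
  assumes "lead_coeff f = 1" "degree f \<noteq> 0" "irreducible f"
  shows "irreducible (map_poly rat_of_int f)"
proof -
  have "primitive f" using irreducible_imp_primitive assms by blast
  then have "irreducible\<^sub>d f" using irreducible_primitive_connect assms by blast
  then show ?thesis using irreducible\<^sub>d_int_rat by simp
qed

lemma map_poly_of_rat_of_int: "map_poly of_rat (map_poly rat_of_int f) = (map_poly of_int f :: complex poly)"
  by (simp add: map_poly_map_poly o_def)

lemma irreducible_common_root:
  fixes f g :: "int poly"
  assumes "lead_coeff f = 1" "degree f \<noteq> 0" "irreducible f"
    and "poly (map_poly of_int f) (a :: complex) = 0" "poly (map_poly of_int g) a = 0"
  shows "map_poly rat_of_int f dvd map_poly rat_of_int g"
  using irreducible_rat_dvd_if_common_root[OF monic_irreducible_rat[OF assms(1-3)], of a "map_poly rat_of_int g"]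
    assms(4,5) by (simp add: map_poly_of_rat_of_int)

lemma irreducible_eq_if_common_root:
  fixes f g :: "int poly"
  assumes f: "lead_coeff f = 1" "degree f \<noteq> 0" "irreducible f"
    and g: "lead_coeff g = 1" "degree g \<noteq> 0" "irreducible g"
    and "poly (map_poly of_int f) (a :: complex) = 0" "poly (map_poly of_int g) a = 0"
  shows "f = g"
proof -
  let ?r = "map_poly rat_of_int"
  have "?r f dvd ?r g" "?r g dvd ?r f" using irreducible_common_root assms by blast+
  moreover have "lead_coeff (?r f) = 1" "lead_coeff (?r g) = 1" using f g by simp_all
  ultimately have "?r f = ?r g"
    using poly_dvd_antisym by metis
  then show ?thesis by simp
qed

text \<open>A common root would make \<open>f\<close> divide its derivative, which is nonzero and of
  smaller degree.\<close>

lemma irreducible_pderiv_nonzero: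
  fixes f :: "int poly"
  assumes f: "lead_coeff f = 1" "degree f \<noteq> 0" "irreducible f"
    and a: "poly (map_poly of_int f) (a :: complex) = 0"
  shows "poly (map_poly of_int (pderiv f)) a \<noteq> 0"
proof
  assume "poly (map_poly of_int (pderiv f)) a = 0"
  with assms have "map_poly rat_of_int f dvd map_poly rat_of_int (pderiv f)"
    by (intro irreducible_common_root)
  moreover have "pderiv f \<noteq> 0" using f(2) by (simp add: pderiv_eq_0_iff)
  ultimately have "degree f \<le> degree (pderiv f)"
    using dvd_imp_degree_le[of "map_poly rat_of_int f" "map_poly rat_of_int (pderiv f)"] by simp
  then show False using f(2) by (simp add: degree_pderiv)
qed

section \<open>The roots of a monic irreducible polynomial\<close>

context
  fixes f :: "int poly"
  assumes monic: "lead_coeff f = 1" and deg: "degree f \<noteq> 0" and irr: "irreducible f"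
begin

text \<open>All roots are simple because the derivative vanishes at none of them. Hence there are as
  many roots as the degree, which is the length of the list.\<close>

lemma distinct_complex_roots_int: "distinct (complex_roots_int f)"
  and set_complex_roots_int: "set (complex_roots_int f) = complex_roots f"
proof -
  let ?f = "map_poly of_int f :: complex poly"
  have f0: "?f \<noteq> 0" using monic by auto
  have eq: "(\<Prod>a\<leftarrow>complex_roots_int f. [:- a, 1:]) = ?f"
    using complex_roots_int(1)[of f] monic by simp
  have "poly ?f x = 0 \<longleftrightarrow> x \<in> set (complex_roots_int f)" for x
    unfolding eq[symmetric] poly_prod_list prod_list_zero_iff by auto
  then show set: "set (complex_roots_int f) = complex_roots f" unfolding complex_roots_def by auto
  have "rsquarefree ?f" unfolding rsquarefree_roots
    using irreducible_pderiv_nonzero[OF monic deg irr] by (auto simp: of_int_hom.map_poly_pderiv)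
  then have "card {x. poly ?f x = 0} = degree f" using rsquarefree_card_degree[OF f0] by simp
  then have "card (set (complex_roots_int f)) = length (complex_roots_int f)"
    unfolding set complex_roots_int(2) complex_roots_def by simp
  then show "distinct (complex_roots_int f)" by (rule card_distinct)
qed

lemma finite_complex_roots_irreducible: "finite (complex_roots f)"
  using set_complex_roots_int by (metis List.finite_set)

lemma card_complex_roots_irreducible: "card (complex_roots f) = degree f"
  using distinct_card[OF distinct_complex_roots_int] set_complex_roots_int complex_roots_int(2)[of f] by simp

lemma irreducible_eq_prod_roots: "map_poly of_int f = (\<Prod>a\<in>complex_roots f. [:- a, 1:])"
  using complex_roots_int(1)[of f] monic
    prod.distinct_set_conv_list[OF distinct_complex_roots_int, of "\<lambda>a. [:- a, 1:]"]
  by (simp add: set_complex_roots_int)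

lemma mahler_measure_irreducible: "mahler_measure f = (\<Prod>a\<in>complex_roots f. max 1 (cmod a))"
  using monic prod.distinct_set_conv_list[OF distinct_complex_roots_int, of "\<lambda>a. max 1 (cmod a)"]
  unfolding mahler_measure_def mahler_measure_poly_def complex_roots_int_def[symmetric] set_complex_roots_int
  by simp

lemma prod_poly_complex_roots_in_Ints: "(\<Prod>a\<in>complex_roots f. poly (map_poly of_int g) a) \<in> \<int>"
proof -
  have "(\<Prod>a\<leftarrow>complex_roots_int f. poly (map_poly of_int g) a) \<in> \<int>"
    by (rule prod_poly_roots_in_Ints[OF monic distinct_complex_roots_int complex_roots_int(2)])
      (simp add: set_complex_roots_int complex_roots_def)
  then show ?thesis
    using prod.distinct_set_conv_list[OF distinct_complex_roots_int, of "poly (map_poly of_int g)"]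
    by (simp add: set_complex_roots_int)
qed

lemma poly_irreducible_eq_prod: "poly (map_poly of_int f) a = (\<Prod>b\<in>complex_roots f. a - b)"
  unfolding irreducible_eq_prod_roots poly_prod by simp

lemma poly_pderiv_irreducible_eq_prod:
  assumes a: "a \<in> complex_roots f"
  shows "poly (map_poly of_int (pderiv f)) a = (\<Prod>b\<in>complex_roots f - {a}. a - b)"
proof -
  let ?A = "complex_roots f"
  have fin: "finite ?A" by (rule finite_complex_roots_irreducible)
  have "poly (map_poly of_int (pderiv f)) a = poly (pderiv (\<Prod>a\<in>?A. [:- a, 1:])) a"
    by (simp add: of_int_hom.map_poly_pderiv irreducible_eq_prod_roots)
  also have "\<dots> = (\<Sum>s\<in>?A. \<Prod>b\<in>?A - {s}. a - b)"
    by (simp add: pderiv_prod poly_sum poly_prod pderiv_pCons)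
  \<comment> \<open>For \<open>s\<close> other than \<open>a\<close> the product contains the factor
    \<open>a - a\<close>.\<close>
  also have "\<dots> = (\<Sum>s\<in>?A. if s = a then \<Prod>b\<in>?A - {a}. a - b else 0)"
    using a fin by (intro sum.cong refl) (auto intro!: prod_zero)
  also have "\<dots> = (\<Prod>b\<in>?A - {a}. a - b)" using a fin by simp
  finally show ?thesis .
qed

end

section \<open>Root distances of irreducible polynomials: resultant and discriminant\<close>

text \<open>With A = max(1, |a|) and B = max(1, |b|), both A and B are at most AB, so |a| + |b| is
  at most 2AB.\<close>

lemma max_1_cmod_diff_le: "cmod (a - b) \<le> 2 * max 1 (cmod a) * max 1 (cmod b)"
proof -
  have "x + y \<le> 2 * (max 1 x * max 1 y)" for x y :: real
  proof -
    have "0 \<le> (max 1 x - 1) * (max 1 y - 1)" by simp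
    moreover have "max 1 x * max 1 y \<ge> max 1 y" "max 1 x * max 1 y \<ge> max 1 x"
      using mult_mono[of 1 "max 1 x" "max 1 y" "max 1 y"] mult_mono[of "max 1 x" "max 1 x" 1 "max 1 y"]
      by auto
    ultimately show ?thesis by linarith
  qed
  from this[of "cmod a" "cmod b"] show ?thesis
    using norm_triangle_ineq4[of a b] by linarith
qed

text \<open>A nonzero integer has absolute value at least 1. The pairs in \<open>J\<close> keep
  their true distance and all others are estimated by \<open>max_1_cmod_diff_le\<close>. Keeping the
  product over \<open>J\<close> on the left saves a factor that matters when a minimal polynomial is
  linear.\<close>

lemma prod_differences_lower_bound:
  fixes I J :: "(complex \<times> complex) set"
  assumes fin: "finite I" and J: "J \<subseteq> I" and ne: "\<And>a b. (a, b) \<in> I \<Longrightarrow> a \<noteq> b"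
    and int: "(\<Prod>(a, b)\<in>I. a - b) \<in> \<int>"
  shows "(\<Prod>(a, b)\<in>J. 2 * max 1 (cmod a) * max 1 (cmod b))
    \<le> (\<Prod>(a, b)\<in>J. cmod (a - b)) * (\<Prod>(a, b)\<in>I. 2 * max 1 (cmod a) * max 1 (cmod b))"
proof -
  let ?m = "\<lambda>(a, b). 2 * max 1 (cmod a) * max 1 (cmod b)" and ?d = "\<lambda>(a, b). cmod (a - b)"
  have sub: "prod h I = prod h J * prod h (I - J)" for h :: "_ \<Rightarrow> real"
    using prod.subset_diff[OF J fin, of h] by (simp add: mult.commute)
  have pos: "prod ?m K > 0" for K by (rule prod_pos) auto
  have "(\<Prod>(a, b)\<in>I. a - b) \<noteq> 0" using fin ne by auto
  then have "1 \<le> cmod (\<Prod>(a, b)\<in>I. a - b)"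
    using int by (auto elim!: Ints_cases)
  also have "\<dots> = prod ?d I" by (simp add: prod_norm[symmetric] case_prod_unfold)
  also have "\<dots> \<le> prod ?d J * prod ?m (I - J)"
    unfolding sub by (intro mult_left_mono prod_mono prod_nonneg) (auto intro: max_1_cmod_diff_le)
  finally have "prod ?m J * 1 \<le> prod ?m J * (prod ?d J * prod ?m (I - J))"
    using pos[of J] by (intro mult_left_mono) auto
  also have "\<dots> = prod ?d J * prod ?m I" unfolding sub by simp
  finally show ?thesis by simp
qed

text \<open>The integer behind this is the resultant of \<open>f\<close> and \<open>g\<close>, the
  product of all differences; it is nonzero because distinct irreducibles share no root. Only the
  pair \<open>(\<alpha>, \<beta>)\<close> is singled out.\<close>

lemma separation_distinct_irreducible:
  fixes f g :: "int poly"
  assumes f: "lead_coeff f = 1" "degree f \<noteq> 0" "irreducible f"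
    and g: "lead_coeff g = 1" "degree g \<noteq> 0" "irreducible g"
    and ne: "f \<noteq> g" and a: "\<alpha> \<in> complex_roots f" and b: "\<beta> \<in> complex_roots g"
  shows "2 * max 1 (cmod \<alpha>) * max 1 (cmod \<beta>)
    \<le> cmod (\<alpha> - \<beta>) * (2 ^ (degree f * degree g) * mahler_measure f ^ degree g * mahler_measure g ^ degree f)"
proof -
  let ?A = "complex_roots f" and ?B = "complex_roots g"
  let ?m = "\<lambda>(a, b). 2 * max 1 (cmod a) * max 1 (cmod b)"
  note fin = finite_complex_roots_irreducible[OF f] finite_complex_roots_irreducible[OF g]
  note card = card_complex_roots_irreducible[OF f] card_complex_roots_irreducible[OF g]
  have neq: "a \<noteq> b" if "(a, b) \<in> ?A \<times> ?B" for a b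
    using irreducible_eq_if_common_root[OF f g] ne that by (auto simp: complex_roots_def)
  have "(\<Prod>(a, b)\<in>?A \<times> ?B. a - b) = (\<Prod>a\<in>?A. poly (map_poly of_int g) a)"
    unfolding poly_irreducible_eq_prod[OF g] by (simp add: prod.cartesian_product)
  then have int: "(\<Prod>(a, b)\<in>?A \<times> ?B. a - b) \<in> \<int>"
    using prod_poly_complex_roots_in_Ints[OF f] by simp
  have "prod ?m {(\<alpha>, \<beta>)} \<le> (\<Prod>(a, b)\<in>{(\<alpha>, \<beta>)}. cmod (a - b)) * prod ?m (?A \<times> ?B)"
    by (rule prod_differences_lower_bound[OF _ _ neq int]) (use fin a b in auto)
  also have "prod ?m (?A \<times> ?B) = (\<Prod>a\<in>?A. \<Prod>b\<in>?B. 2 * max 1 (cmod a) * max 1 (cmod b))"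
    by (simp add: prod.cartesian_product)
  also have "\<dots> = 2 ^ (degree f * degree g) * mahler_measure f ^ degree g * mahler_measure g ^ degree f"
    unfolding mahler_measure_irreducible[OF f] mahler_measure_irreducible[OF g]
    by (simp add: prod.distrib card prod_power_distrib power_mult[symmetric] mult.commute)
  finally show ?thesis by simp
qed

text \<open>Here the integer is the discriminant up to sign, a product over ordered pairs of
  distinct roots. Both \<open>(\<alpha>, \<beta>)\<close> and \<open>(\<beta>, \<alpha>)\<close>
  occur, so the square of the distance is bounded, and taking a square root halves the exponent of
  the Mahler measure.\<close>

lemma separation_same_irreducible:
  fixes f :: "int poly"
  assumes f: "lead_coeff f = 1" "degree f \<noteq> 0" "irreducible f"
    and a: "\<alpha> \<in> complex_roots f" and b: "\<beta> \<in> complex_roots f" and ne: "\<alpha> \<noteq> \<beta>"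
  shows "1 \<le> cmod (\<alpha> - \<beta>) * (2 ^ (degree f * (degree f - 1)) * mahler_measure f ^ (degree f - 1))"
proof -
  let ?A = "complex_roots f" and ?n = "degree f" and ?M = "mahler_measure f"
  let ?m = "\<lambda>(a, b). 2 * max 1 (cmod a) * max 1 (cmod b)"
  let ?I = "Sigma ?A (\<lambda>a. ?A - {a})" and ?J = "{(\<alpha>, \<beta>), (\<beta>, \<alpha>)}"
  note fin = finite_complex_roots_irreducible[OF f] and card = card_complex_roots_irreducible[OF f]
  have "(\<Prod>(a, b)\<in>?I. a - b) = (\<Prod>a\<in>?A. \<Prod>b\<in>?A - {a}. a - b)"
    using fin by (subst prod.Sigma) auto
  also have "\<dots> = (\<Prod>a\<in>?A. poly (map_poly of_int (pderiv f)) a)"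
    by (intro prod.cong refl) (simp add: poly_pderiv_irreducible_eq_prod[OF f])
  finally have int: "(\<Prod>(a, b)\<in>?I. a - b) \<in> \<int>"
    using prod_poly_complex_roots_in_Ints[OF f] by simp
  have m_pos: "?m p > 0" "?m p \<ge> 1" for p
  proof -
    obtain a b where p: "p = (a, b)" by force
    have "1 \<le> max 1 (cmod a) * max 1 (cmod b)"
      using mult_mono[of 1 "max 1 (cmod a)" 1 "max 1 (cmod b)"] by simp
    then show "?m p > 0" "?m p \<ge> 1" unfolding p by auto
  qed
  have M: "?M \<ge> 1" using mahler_measure_poly_ge_1[of f] f by auto
  have "1 \<le> prod ?m ?J" by (rule prod_ge_1) (rule m_pos)
  also have "prod ?m ?J \<le> (\<Prod>(a, b)\<in>?J. cmod (a - b)) * prod ?m ?I"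
    by (rule prod_differences_lower_bound[OF _ _ _ int]) (use fin a b ne in auto)
  also have "(\<Prod>(a, b)\<in>?J. cmod (a - b)) = cmod (\<alpha> - \<beta>) ^ 2"
    using ne by (simp add: power2_eq_square norm_minus_commute)
  also have "prod ?m ?I = (\<Prod>a\<in>?A. \<Prod>b\<in>?A - {a}. 2 * max 1 (cmod a) * max 1 (cmod b))"
    using fin by (subst prod.Sigma) auto
  also have "\<dots> = (\<Prod>a\<in>?A. 2 ^ (?n - 1) * max 1 (cmod a) ^ (?n - 1) * (?M / max 1 (cmod a)))"
  proof (rule prod.cong[OF refl])
    fix a assume a: "a \<in> ?A"
    then have "?M = max 1 (cmod a) * (\<Prod>b\<in>?A - {a}. max 1 (cmod b))"
      unfolding mahler_measure_irreducible[OF f] by (rule prod.remove[OF fin])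
    then have "(\<Prod>b\<in>?A - {a}. max 1 (cmod b)) = ?M / max 1 (cmod a)"
      by (simp add: field_simps)
    moreover have "card (?A - {a}) = ?n - 1" using a card fin by simp
    ultimately show "(\<Prod>b\<in>?A - {a}. 2 * max 1 (cmod a) * max 1 (cmod b))
      = 2 ^ (?n - 1) * max 1 (cmod a) ^ (?n - 1) * (?M / max 1 (cmod a))"
      by (simp add: prod.distrib power_mult_distrib)
  qed
  \<comment> \<open>Each \<open>max 1 (cmod a)\<close> occurs to the power \<open>?n - 1\<close>,
    and the quotients by \<open>max 1 (cmod a)\<close> multiply to
    \<open>?M ^ ?n / ?M\<close>.\<close>
  also have "\<dots> = 2 ^ (?n * (?n - 1)) * ?M ^ (?n - 1) * (?M ^ ?n / ?M)"
    by (simp add: prod.distrib prod_dividef card prod_power_distrib[symmetric] power_mult[symmetric]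
        mahler_measure_irreducible[OF f, symmetric] mult.commute)
  also have "?M ^ ?n / ?M = ?M ^ (?n - 1)"
    using M f(2) by (cases ?n) auto
  finally have "1 \<le> cmod (\<alpha> - \<beta>) ^ 2 * (2 ^ (?n * (?n - 1)) * ?M ^ (?n - 1) * ?M ^ (?n - 1))" .
  \<comment> \<open>A second power of 2 is inserted to turn the right-hand side into a perfect
    square.\<close>
  also have "\<dots> \<le> cmod (\<alpha> - \<beta>) ^ 2 * (2 ^ (?n * (?n - 1)) * ?M ^ (?n - 1) * ?M ^ (?n - 1) * 2 ^ (?n * (?n - 1)))"
    by (intro mult_left_mono) (use M in \<open>auto intro: mult_right_le_one_le\<close>)
  also have "\<dots> = (cmod (\<alpha> - \<beta>) * (2 ^ (?n * (?n - 1)) * ?M ^ (?n - 1))) ^ 2"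
    by (simp add: power2_eq_square algebra_simps)
  finally have "1 ^ 2 \<le> (cmod (\<alpha> - \<beta>) * (2 ^ (?n * (?n - 1)) * ?M ^ (?n - 1))) ^ 2" by simp
  then show ?thesis by (rule power2_le_imp_le) (use M in auto)
qed

section \<open>Separation for reducible polynomials in terms of the Mahler measure\<close>

text \<open>Induction on the degree: one of two proper factors has the root, and both can be made
  monic.\<close>

lemma monic_irreducible_factor_of_root:
  fixes P :: "int poly"
  assumes "lead_coeff P = 1" "\<alpha> \<in> complex_roots P"
  shows "\<exists>f. lead_coeff f = 1 \<and> degree f \<noteq> 0 \<and> irreducible f \<and> f dvd P \<and> \<alpha> \<in> complex_roots f"
  using assms
proof (induction "degree P" arbitrary: P rule: less_induct)
  case less
  have dP: "degree P \<noteq> 0"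
  proof
    assume "degree P = 0"
    then have "P = 1" using less.prems(1) by (metis monic_degree_0)
    then show False using less.prems(2) by (simp add: complex_roots_def)
  qed
  show ?case
  proof (cases "irreducible P")
    case True
    with less.prems dP show ?thesis by (intro exI[of _ P] conjI) simp_all
  next
    case False
    have "\<not> P dvd 1" "P \<noteq> 0" using dP by (auto simp: poly_dvd_1)
    then obtain a b where ab: "P = a * b" "\<not> a dvd 1" "\<not> b dvd 1"
      using False by (auto simp: irreducible_def)
    have "lead_coeff a * lead_coeff b = 1" using less.prems(1) ab(1) by (simp add: lead_coeff_mult)
    then have lc: "lead_coeff a = 1 \<and> lead_coeff b = 1 \<or> lead_coeff a = -1 \<and> lead_coeff b = -1"
      by (auto simp: zmult_eq_1_iff)
    \<comment> \<open>The leading coefficients are both 1 or both -1, so scaling both factors by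
      \<open>s\<close> makes them monic and leaves the product unchanged.\<close>
    define s where "s = lead_coeff a"
    define a' b' where "a' = smult s a" and "b' = smult s b"
    have s: "s * s = 1" "s \<noteq> 0" using lc s_def by auto
    have P: "P = a' * b'" unfolding a'_def b'_def using ab(1) s by (simp add: mult.assoc)
    have lc': "lead_coeff a' = 1" "lead_coeff b' = 1" using lc unfolding a'_def b'_def s_def by auto
    have deg': "degree a' = degree a" "degree b' = degree b" unfolding a'_def b'_def using s by auto
    have da: "degree a \<noteq> 0" "degree b \<noteq> 0"
      using ab(2,3) lc by (auto simp: poly_dvd_1 intro!: gr0I)
    have "degree P = degree a + degree b"
      using ab(1) lc by (metis degree_mult_eq leading_coeff_0_iff one_neq_zero zero_neq_neg_one)
    then have lt: "degree a' < degree P" "degree b' < degree P" using da deg' by auto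
    have "\<alpha> \<in> complex_roots a' \<or> \<alpha> \<in> complex_roots b'"
      using less.prems(2) unfolding complex_roots_def P by (simp add: of_int_poly_hom.hom_mult)
    then obtain f where "lead_coeff f = 1" "degree f \<noteq> 0" "irreducible f" "f dvd a' \<or> f dvd b'" "\<alpha> \<in> complex_roots f"
      using less.hyps[OF lt(1) lc'(1)] less.hyps[OF lt(2) lc'(2)] by blast
    then show ?thesis unfolding P by (metis dvd_mult dvd_mult2)
  qed
qed

text \<open>If both roots have the same minimal polynomial, it is a proper factor of
  \<open>P\<close>, so its degree minus 1 is at most \<open>d - 2\<close>. Otherwise
  \<open>f * g\<close> divides \<open>P\<close>, and the exponents in the resultant bound exceed
  \<open>d - 2\<close> only if one factor is linear.\<close>

lemma separation_mahler:
  fixes P :: "int poly"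
  assumes monic: "lead_coeff P = 1" and red: "\<not> irreducible (map_poly of_int P :: rat poly)"
    and deg: "degree P = d" "d \<ge> 3"
    and roots: "\<alpha> \<in> complex_roots P" "\<beta> \<in> complex_roots P" and ne: "\<alpha> \<noteq> \<beta>"
  shows "1 \<le> cmod (\<alpha> - \<beta>) * (2 ^ (d * d) * mahler_measure P ^ (d - 2))"
proof -
  obtain f where f: "lead_coeff f = 1" "degree f \<noteq> 0" "irreducible f" and fP: "f dvd P" and fa: "\<alpha> \<in> complex_roots f"
    using monic_irreducible_factor_of_root[OF monic roots(1)] by blast
  obtain g where g: "lead_coeff g = 1" "degree g \<noteq> 0" "irreducible g" and gP: "g dvd P" and gb: "\<beta> \<in> complex_roots g"
    using monic_irreducible_factor_of_root[OF monic roots(2)] by blast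
  let ?M = mahler_measure and ?n = "degree f" and ?k = "degree g"
  have P0: "P \<noteq> 0" using monic by auto
  have M: "?M P \<ge> 1" "?M f \<ge> 1" "?M g \<ge> 1"
    using mahler_measure_poly_ge_1 P0 f g by auto
  have step: "1 \<le> cmod (\<alpha> - \<beta>) * (2 ^ (d * d) * ?M P ^ (d - 2))"
    if "1 \<le> cmod (\<alpha> - \<beta>) * (2 ^ k * X)" "k \<le> d * d" "X \<le> ?M P ^ (d - 2)" for X :: real and k
  proof -
    note that(1)
    also have "cmod (\<alpha> - \<beta>) * (2 ^ k * X) \<le> cmod (\<alpha> - \<beta>) * (2 ^ k * ?M P ^ (d - 2))"
      using that(3) by (intro mult_left_mono) auto
    also have "\<dots> \<le> cmod (\<alpha> - \<beta>) * (2 ^ (d * d) * ?M P ^ (d - 2))"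
      using that(2) M(1) by (intro mult_left_mono mult_right_mono power_increasing) auto
    finally show ?thesis .
  qed
  show ?thesis
  proof (cases "f = g")
    case True
    \<comment> \<open>This is where reducibility enters: a factor of full degree would be
      \<open>P\<close> itself.\<close>
    have "?n \<noteq> d"
    proof
      assume n: "?n = d"
      obtain k where k: "P = f * k" using fP by blast
      have "lead_coeff k = 1" using k monic f(1) by (simp add: lead_coeff_mult)
      moreover from k P0 have "degree P = degree f + degree k" by (simp add: degree_mult_eq)
      then have "degree k = 0" using n deg by simp
      ultimately have "k = 1" by (metis monic_degree_0)
      then show False using k red monic_irreducible_rat[OF f] by simp
    qed
    moreover have "?n \<le> d" using dvd_imp_degree_le[OF fP P0] deg by simp
    ultimately have n: "?n - 1 \<le> d - 2" "?n \<le> d" by auto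
    have "1 \<le> cmod (\<alpha> - \<beta>) * (2 ^ (?n * (?n - 1)) * ?M f ^ (?n - 1))"
      using separation_same_irreducible[OF f fa _ ne] gb True by simp
    moreover have "?n * (?n - 1) \<le> d * d" using n by (intro mult_le_mono) auto
    moreover have "?M f ^ (?n - 1) \<le> ?M P ^ (d - 2)"
    proof -
      have "?M f ^ (?n - 1) \<le> ?M P ^ (?n - 1)"
        using mahler_measure_dvd[OF P0 fP] M by (intro power_mono) auto
      also have "\<dots> \<le> ?M P ^ (d - 2)" using n M by (intro power_increasing) auto
      finally show ?thesis .
    qed
    ultimately show ?thesis by (rule step)
  next
    case False
    obtain k where k: "P = f * k" using fP by blast
    have "prime_elem g" using g(3) by simp
    moreover have "\<not> g dvd f"
    proof
      assume "g dvd f"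
      then have "\<beta> \<in> complex_roots f" using gb
        by (auto simp: complex_roots_def of_int_poly_hom.hom_mult elim!: dvdE)
      then show False using irreducible_eq_if_common_root[OF f g] gb False by (simp add: complex_roots_def)
    qed
    \<comment> \<open>As \<open>g\<close> is prime and does not divide \<open>f\<close>, it divides
      the cofactor.\<close>
    ultimately have "g dvd k" using gP prime_elem_dvd_multD[of g f k] k by auto
    then have fg: "f * g dvd P" unfolding k by (rule mult_dvd_mono[OF dvd_refl])
    have fg0: "f \<noteq> 0" "g \<noteq> 0" using f g by auto
    have dfg: "?n + ?k \<le> d" using dvd_imp_degree_le[OF fg P0] deg fg0 by (simp add: degree_mult_eq)
    have Mfg: "?M f * ?M g \<le> ?M P"
      using mahler_measure_dvd[OF P0 fg]
      by (simp add: mahler_measure_def measure_eq_prod of_int_poly_hom.hom_mult)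
    let ?a = "max 1 (cmod \<alpha>)" and ?b = "max 1 (cmod \<beta>)"
    have Ma: "?M f = ?a" if "?n = 1"
    proof -
      have "complex_roots f = {\<alpha>}"
        using card_complex_roots_irreducible[OF f] that fa by (auto simp: card_1_singleton_iff)
      then show ?thesis using mahler_measure_irreducible[OF f] by simp
    qed
    have Mb: "?M g = ?b" if "?k = 1"
    proof -
      have "complex_roots g = {\<beta>}"
        using card_complex_roots_irreducible[OF g] that gb by (auto simp: card_1_singleton_iff)
      then show ?thesis using mahler_measure_irreducible[OF g] by simp
    qed
    \<comment> \<open>For linear \<open>f\<close> the exponent may reach \<open>d - 1\<close>, but
      then the Mahler measure of \<open>f\<close> equals \<open>?a\<close>, and the surplus factor
      cancels against the left-hand side of the resultant bound.\<close>
    have le_a: "?M f ^ ?k \<le> ?a * ?M f ^ (d - 2)"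
    proof (cases "?n = 1")
      case True
      have "?M f ^ ?k \<le> ?M f ^ Suc (d - 2)" using M dfg True deg by (intro power_increasing) auto
      then show ?thesis using Ma[OF True] by simp
    next
      case n1: False
      have "1 * ?M f ^ ?k \<le> ?a * ?M f ^ (d - 2)"
        using M dfg n1 f(2) by (intro mult_mono power_increasing) auto
      then show ?thesis by simp
    qed
    have le_b: "?M g ^ ?n \<le> ?b * ?M g ^ (d - 2)"
    proof (cases "?k = 1")
      case True
      have "?M g ^ ?n \<le> ?M g ^ Suc (d - 2)" using M dfg True deg by (intro power_increasing) auto
      then show ?thesis using Mb[OF True] by simp
    next
      case n1: False
      have "1 * ?M g ^ ?n \<le> ?b * ?M g ^ (d - 2)"
        using M dfg n1 g(2) by (intro mult_mono power_increasing) auto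
      then show ?thesis by simp
    qed
    have "2 * ?a * ?b \<le> cmod (\<alpha> - \<beta>) * (2 ^ (?n * ?k) * ?M f ^ ?k * ?M g ^ ?n)"
      by (rule separation_distinct_irreducible[OF f g False fa gb])
    also have "\<dots> = cmod (\<alpha> - \<beta>) * 2 ^ (?n * ?k) * (?M f ^ ?k * ?M g ^ ?n)" by simp
    also have "\<dots> \<le> cmod (\<alpha> - \<beta>) * 2 ^ (?n * ?k) * ((?a * ?M f ^ (d - 2)) * (?b * ?M g ^ (d - 2)))"
      using le_a le_b M by (intro mult_left_mono mult_mono) auto
    also have "\<dots> = ?a * ?b * (cmod (\<alpha> - \<beta>) * (2 ^ (?n * ?k) * (?M f * ?M g) ^ (d - 2)))"
      by (simp add: power_mult_distrib)
    finally have "?a * ?b * 2 \<le> ?a * ?b * (cmod (\<alpha> - \<beta>) * (2 ^ (?n * ?k) * (?M f * ?M g) ^ (d - 2)))"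
      by (simp add: mult_ac)
    moreover have "?a * ?b > 0" by simp
    ultimately have "2 \<le> cmod (\<alpha> - \<beta>) * (2 ^ (?n * ?k) * (?M f * ?M g) ^ (d - 2))"
      using mult_le_cancel_left_pos by blast
    then have "1 \<le> cmod (\<alpha> - \<beta>) * (2 ^ (?n * ?k) * (?M f * ?M g) ^ (d - 2))" by linarith
    moreover have "?n * ?k \<le> d * d" using dfg by (intro mult_le_mono) auto
    moreover have "(?M f * ?M g) ^ (d - 2) \<le> ?M P ^ (d - 2)"
      using Mfg M by (intro power_mono) auto
    ultimately show ?thesis by (rule step)
  qed
qed

section \<open>From the Mahler measure to the height, and the upper bound\<close>

lemma abs_coeff_le_height: "\<bar>coeff P i\<bar> \<le> height P" if "P \<noteq> 0"
proof -
  have eq: "{\<bar>coeff P i\<bar> | i. i \<le> degree P} = (\<lambda>i. \<bar>coeff P i\<bar>) ` {..degree P}" by auto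
  show ?thesis
  proof (cases "i \<le> degree P")
    case True
    then show ?thesis unfolding height_def eq by (intro Max_ge) auto
  next
    case False
    have "\<bar>coeff P 0\<bar> \<le> height P" unfolding height_def eq by (intro Max_ge) auto
    then have "0 \<le> height P" by linarith
    then show ?thesis using False by (simp add: coeff_eq_0)
  qed
qed

lemma height_le: "height P \<le> B" if "\<And>i. \<bar>coeff P i\<bar> \<le> B"
proof -
  have eq: "{\<bar>coeff P i\<bar> | i. i \<le> degree P} = (\<lambda>i. \<bar>coeff P i\<bar>) ` {..degree P}" by auto
  show ?thesis unfolding height_def eq using that by (intro Max.boundedI) auto
qed

text \<open>Landau's inequality bounds the Mahler measure by the Euclidean norm of the coefficients.
  The resulting factor, the square root of \<open>degree P + 1\<close>, is weakened to
  \<open>degree P + 1\<close>.\<close>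

lemma mahler_measure_le_height:
  assumes "P \<noteq> 0"
  shows "mahler_measure P \<le> real (degree P + 1) * real_of_int (height P)"
proof -
  let ?P = "map_poly complex_of_int P" and ?H = "real_of_int (height P)"
  have H0: "0 \<le> ?H" using abs_coeff_le_height[OF assms, of 0] by linarith
  have "(\<Sum>a\<leftarrow>coeffs ?P. (cmod a)\<^sup>2) \<le> (\<Sum>a\<leftarrow>coeffs ?P. ?H\<^sup>2)"
  proof (rule sum_list_mono)
    fix a assume "a \<in> set (coeffs ?P)"
    then obtain i where "a = coeff ?P i" by (metis in_set_conv_nth length_coeffs nth_coeffs_coeff coeffs_nth less_Suc_eq_le length_coeffs_degree coeffs_eq_Nil empty_iff list.set(1))
    then have "cmod a = \<bar>real_of_int (coeff P i)\<bar>" by simp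
    also have "\<dots> = real_of_int \<bar>coeff P i\<bar>" by simp
    also have "\<dots> \<le> ?H" using abs_coeff_le_height[OF assms] of_int_le_iff by blast
    finally show "(cmod a)\<^sup>2 \<le> ?H\<^sup>2" by (intro power_mono) auto
  qed
  also have "\<dots> = (degree P + 1) * ?H\<^sup>2"
    using assms by (simp add: sum_list_triv length_coeffs_degree o_def)
  also have "\<dots> \<le> (degree P + 1)\<^sup>2 * ?H\<^sup>2"
    by (intro mult_right_mono) (auto simp: power2_eq_square)
  also have "\<dots> = ((degree P + 1) * ?H)\<^sup>2" by (simp add: power_mult_distrib)
  finally have "sqrt (\<Sum>a\<leftarrow>coeffs ?P. (cmod a)\<^sup>2) \<le> (degree P + 1) * ?H"
    using H0 by (intro real_le_lsqrt) (auto intro: sum_list_nonneg)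
  then show ?thesis using Landau_inequality[of ?P] unfolding mahler_measure_def by linarith
qed

lemma finite_complex_roots: "P \<noteq> 0 \<Longrightarrow> finite (complex_roots P)"
  unfolding complex_roots_def by (rule poly_roots_finite) simp

lemma finite_root_distances:
  "P \<noteq> 0 \<Longrightarrow> finite {cmod (\<alpha> - \<beta>) | \<alpha> \<beta>. \<alpha> \<in> complex_roots P \<and> \<beta> \<in> complex_roots P \<and> \<alpha> \<noteq> \<beta>}"
  by (rule finite_subset[of _ "(\<lambda>(a, b). cmod (a - b)) ` (complex_roots P \<times> complex_roots P)"])
    (auto simp: finite_complex_roots)

lemma root_sep_le:
  "P \<noteq> 0 \<Longrightarrow> \<alpha> \<in> complex_roots P \<Longrightarrow> \<beta> \<in> complex_roots P \<Longrightarrow> \<alpha> \<noteq> \<beta> \<Longrightarrow> root_sep P \<le> cmod (\<alpha> - \<beta>)"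
  unfolding root_sep_def by (rule Min_le[OF finite_root_distances]) auto

lemma root_sep_attained:
  assumes "P \<noteq> 0" "\<alpha> \<in> complex_roots P" "\<beta> \<in> complex_roots P" "\<alpha> \<noteq> \<beta>"
  obtains \<gamma> \<delta> where "\<gamma> \<in> complex_roots P" "\<delta> \<in> complex_roots P" "\<gamma> \<noteq> \<delta>" "root_sep P = cmod (\<gamma> - \<delta>)"
proof -
  have "root_sep P \<in> {cmod (\<alpha> - \<beta>) | \<alpha> \<beta>. \<alpha> \<in> complex_roots P \<and> \<beta> \<in> complex_roots P \<and> \<alpha> \<noteq> \<beta>}"
    unfolding root_sep_def by (rule Min_in[OF finite_root_distances]) (use assms in blast)+
  then show ?thesis using that by blast
qed

text \<open>Logarithms of the separation bound, with a constant \<open>C\<close> depending only on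
  \<open>d\<close>. The error term uses the threshold \<open>H\<close> in place of the height so as
  to be uniform in \<open>P\<close>.\<close>

lemma sep_exponent_le:
  assumes P: "P \<in> monic_reducible_polys d" and d: "d \<ge> 3" and H: "height P \<ge> H" "H \<ge> 2"
  defines "C \<equiv> 2 ^ (d * d) * (real d + 1) ^ (d - 2)"
  shows "sep_exponent P \<le> real (d - 2) + ln C / ln H"
proof -
  have deg: "degree P = d" and monic: "lead_coeff P = 1"
    and red: "\<not> irreducible (map_poly of_int P :: rat poly)"
    using P unfolding monic_reducible_polys_def by auto
  have P0: "P \<noteq> 0" using monic by auto
  obtain \<alpha> \<beta> where r: "\<alpha> \<in> complex_roots P" "\<beta> \<in> complex_roots P" "\<alpha> \<noteq> \<beta>"
    using P unfolding monic_reducible_polys_def by blast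
  obtain \<gamma> \<delta> where gd: "\<gamma> \<in> complex_roots P" "\<delta> \<in> complex_roots P" "\<gamma> \<noteq> \<delta>" "root_sep P = cmod (\<gamma> - \<delta>)"
    using root_sep_attained[OF P0 r] .
  let ?h = "real_of_int (height P)" and ?M = "mahler_measure P"
  have h: "?h \<ge> 2" "?h \<ge> H" using H by linarith+
  have C: "C \<ge> 1" unfolding C_def using one_le_power[of "2::real" "d*d"] one_le_power[of "real d + 1" "d - 2"]
      mult_mono[of 1 "2 ^ (d * d) :: real" 1 "(real d + 1) ^ (d - 2)"] by simp
  have pos: "root_sep P > 0" using gd by simp
  have "1 \<le> root_sep P * (2 ^ (d * d) * ?M ^ (d - 2))"
    unfolding gd(4) by (rule separation_mahler[OF monic red deg d gd(1-3)])
  also have "\<dots> \<le> root_sep P * (2 ^ (d * d) * ((real d + 1) * ?h) ^ (d - 2))"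
    using mahler_measure_le_height[OF P0] mahler_measure_ge_0 pos deg
    by (intro mult_left_mono power_mono) (auto simp: add.commute)
  also have "\<dots> = root_sep P * (C * ?h ^ (d - 2))"
    unfolding C_def by (simp add: power_mult_distrib)
  finally have "0 \<le> ln (root_sep P * (C * ?h ^ (d - 2)))" by simp
  also have "\<dots> = ln (root_sep P) + (ln C + real (d - 2) * ln ?h)"
    using pos C h by (simp add: ln_mult ln_realpow)
  finally have "- ln (root_sep P) \<le> real (d - 2) * ln ?h + ln C" by linarith
  moreover have lh: "ln ?h > 0" using h by simp
  ultimately have "sep_exponent P \<le> (real (d - 2) * ln ?h + ln C) / ln ?h"
    unfolding sep_exponent_def by (intro divide_right_mono) auto
  also have "\<dots> = real (d - 2) + ln C / ln ?h" using lh by (simp add: add_divide_distrib)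
  also have "\<dots> \<le> real (d - 2) + ln C / ln H"
    using C h H by (intro add_left_mono divide_left_mono) auto
  finally show ?thesis .
qed

text \<open>Every height threshold \<open>n\<close> bounds the infimum, and the error term tends to
  0 with growing \<open>n\<close>.\<close>

lemma e_r_star_le:
  assumes d: "d \<ge> 3"
  shows "e_r_star d \<le> ereal (real (d - 2))"
proof -
  define C where "C = 2 ^ (d * d) * (real d + 1) ^ (d - 2)"
  have "e_r_star d \<le> ereal (real (d - 2) + ln C / ln (real n))" if "n \<ge> 2" for n
    unfolding e_r_star_eq_INF
  proof (rule INF_lower2[of "int n"])
    show "(SUP P\<in>{P \<in> monic_reducible_polys d. int n \<le> height P}. ereal (sep_exponent P))
      \<le> ereal (real (d - 2) + ln C / ln (real n))"
      using sep_exponent_le[of _ d "int n"] d that unfolding C_def by (auto intro!: SUP_least)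
  qed simp
  then have "eventually (\<lambda>n. e_r_star d \<le> ereal (real (d - 2) + ln C / ln (real n))) sequentially"
    by (auto simp: eventually_at_top_linorder)
  moreover have "(\<lambda>n. real (d - 2) + ln C / ln (real n)) \<longlonglongrightarrow> real (d - 2)"
    by real_asymp
  then have "(\<lambda>n. ereal (real (d - 2) + ln C / ln (real n))) \<longlonglongrightarrow> ereal (real (d - 2))"
    by (rule tendsto_ereal)
  ultimately show ?thesis
    by (intro tendsto_lowerbound) auto
qed

section \<open>Lower bounds\<close>

text \<open>This is the estimate of q'/q, the sum of all 1/(z - a), multiplied out so that no
  division by zero can arise.\<close>

lemma pderiv_bound_if_roots_far:
  fixes z :: complex
  assumes "\<And>a. a \<in> set as \<Longrightarrow> \<delta> \<le> cmod (z - a)"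
  shows "\<delta> * cmod (poly (pderiv (\<Prod>a\<leftarrow>as. [:- a, 1:])) z) \<le> length as * cmod (poly (\<Prod>a\<leftarrow>as. [:- a, 1:]) z)"
  using assms
proof (induction as)
  case (Cons b as)
  let ?q = "\<Prod>a\<leftarrow>as. [:- a, 1:]"
  have \<delta>: "\<delta> \<le> cmod (z - b)" using Cons.prems by simp
  have IH: "\<delta> * cmod (poly (pderiv ?q) z) \<le> length as * cmod (poly ?q z)"
    using Cons by simp
  have "poly (pderiv ([:- b, 1:] * ?q)) z = poly ?q z + (z - b) * poly (pderiv ?q) z"
    by (simp add: pderiv_mult pderiv_pCons algebra_simps del: mult_pCons_left)
  then have "cmod (poly (pderiv ([:- b, 1:] * ?q)) z)
      \<le> cmod (poly ?q z) + cmod (z - b) * cmod (poly (pderiv ?q) z)"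
    by (simp only: norm_mult[symmetric]) (rule norm_triangle_ineq)
  show ?case
  proof (cases "\<delta> \<ge> 0")
    case True
    have "\<delta> * cmod (poly (pderiv ([:- b, 1:] * ?q)) z)
      \<le> \<delta> * (cmod (poly ?q z) + cmod (z - b) * cmod (poly (pderiv ?q) z))"
      by (rule mult_left_mono) fact+
    also have "\<dots> = \<delta> * cmod (poly ?q z) + cmod (z - b) * (\<delta> * cmod (poly (pderiv ?q) z))"
      by (simp add: algebra_simps)
    also have "\<dots> \<le> cmod (z - b) * cmod (poly ?q z) + cmod (z - b) * (length as * cmod (poly ?q z))"
      using \<delta> IH by (intro add_mono mult_right_mono mult_left_mono) auto
    also have "\<dots> = length (b # as) * cmod (poly ([:- b, 1:] * ?q) z)"
    proof -
      have "poly ([:- b, 1:] * ?q) z = (z - b) * poly ?q z"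
        unfolding poly_mult by (simp add: algebra_simps)
      then show ?thesis by (simp add: norm_mult distrib_right del: mult_pCons_left)
    qed
    finally show ?thesis by simp
  next
    case False
    then have "\<delta> * cmod (poly (pderiv (\<Prod>a\<leftarrow>b # as. [:- a, 1:])) z) \<le> 0"
      by (intro mult_nonpos_nonneg) auto
    then show ?thesis by (rule order_trans) simp
  qed
qed simp

text \<open>Otherwise the smallest distance from \<open>z\<close> to a root, taken as the radius in
  \<open>pderiv_bound_if_roots_far\<close>, contradicts that estimate.\<close>

lemma ex_root_near:
  fixes q :: "int poly" and z :: complex
  assumes monic: "lead_coeff q = 1" and d: "poly (map_poly of_int (pderiv q)) z \<noteq> 0"
  shows "\<exists>a\<in>complex_roots q. cmod (z - a)
    \<le> degree q * cmod (poly (map_poly of_int q) z) / cmod (poly (map_poly of_int (pderiv q)) z)"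
proof (rule ccontr)
  assume "\<not> ?thesis"
  then have far: "degree q * cmod (poly (map_poly of_int q) z) / cmod (poly (map_poly of_int (pderiv q)) z) < cmod (z - a)"
    if "a \<in> complex_roots q" for a using that by force
  let ?as = "complex_roots_int q" and ?q = "map_poly of_int q :: complex poly"
  let ?B = "degree q * cmod (poly ?q z) / cmod (poly (pderiv ?q) z)"
  have d': "cmod (poly (pderiv ?q) z) > 0" using d by (simp add: of_int_hom.map_poly_pderiv)
  have eq: "(\<Prod>a\<leftarrow>?as. [:- a, 1:]) = ?q" and len: "length ?as = degree q"
    using complex_roots_int[of q] monic by simp_all
  have set: "a \<in> complex_roots q" if "a \<in> set ?as" for a
    using that unfolding complex_roots_def mem_Collect_eq eq[symmetric] poly_prod_list prod_list_zero_iff by auto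
  have ne: "set ?as \<noteq> {}"
  proof
    assume "set ?as = {}"
    then have "degree q = 0" using len by simp
    then have "pderiv q = 0" by (simp add: pderiv_eq_0_iff)
    then show False using d by simp
  qed
  define \<delta> where "\<delta> = Min ((\<lambda>a. cmod (z - a)) ` set ?as)"
  have "\<delta> \<in> (\<lambda>a. cmod (z - a)) ` set ?as" unfolding \<delta>_def using ne by (intro Min_in) auto
  then have "?B < \<delta>" using far set by (auto simp: of_int_hom.map_poly_pderiv)
  moreover have "\<delta> * cmod (poly (pderiv ?q) z) \<le> degree q * cmod (poly ?q z)"
    using pderiv_bound_if_roots_far[of ?as \<delta> z] unfolding eq len \<delta>_def by auto
  then have "\<delta> \<le> ?B" using d' by (simp add: pos_le_divide_eq)
  ultimately show False by simp
qed

section \<open>A criterion for lower bounds from products with a quadratic factor\<close>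

lemma complex_roots_mult: "complex_roots (p * q) = complex_roots p \<union> complex_roots q"
  unfolding complex_roots_def of_int_poly_hom.hom_mult poly_mult mult_eq_0_iff by blast

lemma poly_of_int_of_real:
  "poly (map_poly of_int p) (complex_of_real x) = of_real (poly (map_poly of_int p) x)"
  by (induction p) (simp_all add: map_poly_pCons)

lemma height_mult_quadratic_le:
  assumes A: "\<And>i. \<bar>coeff Q i\<bar> \<le> A"
  shows "height ([:v, u, 1:] * Q) \<le> (\<bar>v\<bar> + \<bar>u\<bar> + 1) * A"
proof (rule height_le)
  fix i
  \<comment> \<open>Subtraction of natural numbers truncates, so the conditionals supply the value 0
    for coefficients with negative index.\<close>
  define a b c where "a = coeff Q i" and "b = (if i \<ge> 1 then coeff Q (i - 1) else 0)"
    and "c = (if i \<ge> 2 then coeff Q (i - 2) else 0)"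
  have A0: "0 \<le> A" using A[of 0] by linarith
  have abc: "\<bar>a\<bar> \<le> A" "\<bar>b\<bar> \<le> A" "\<bar>c\<bar> \<le> A" unfolding a_def b_def c_def using A A0 by auto
  have "coeff ([:v, u, 1:] * Q) i = v * a + u * b + c"
    by (simp add: a_def b_def c_def coeff_pCons numeral_2_eq_2 split: nat.split)
  also have "\<bar>\<dots>\<bar> \<le> \<bar>v\<bar> * \<bar>a\<bar> + \<bar>u\<bar> * \<bar>b\<bar> + \<bar>c\<bar>"
    by (simp only: abs_mult[symmetric])
  also have "\<dots> \<le> \<bar>v\<bar> * A + \<bar>u\<bar> * A + A" using abc by (intro add_mono mult_left_mono) auto
  finally show "\<bar>coeff ([:v, u, 1:] * Q) i\<bar> \<le> (\<bar>v\<bar> + \<bar>u\<bar> + 1) * A" by (simp add: algebra_simps)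
qed

lemma mult_quadratic_in_monic_reducible_polys:
  assumes "lead_coeff Q = 1" "degree Q = n" "n \<ge> 1"
    and "\<alpha> \<in> complex_roots Q" "\<beta> \<in> complex_roots [:v, u, 1:]" "\<alpha> \<noteq> \<beta>"
  shows "[:v, u, 1:] * Q \<in> monic_reducible_polys (n + 2)"
proof -
  let ?R = "[:v, u, 1:]"
  have "Q \<noteq> 0" using assms by auto
  then have "degree (?R * Q) = n + 2" using assms by (subst degree_mult_eq) auto
  moreover have "lead_coeff (?R * Q) = 1" using assms by (simp add: lead_coeff_mult del: mult_pCons_left)
  moreover have "\<not> irreducible (map_poly of_int (?R * Q) :: rat poly)"
  proof
    assume "irreducible (map_poly of_int (?R * Q) :: rat poly)"
    then have "is_unit (map_poly of_int ?R :: rat poly) \<or> is_unit (map_poly of_int Q :: rat poly)"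
      unfolding of_int_poly_hom.hom_mult by (rule irreducibleD[OF _ refl])
    then have "degree (map_poly of_int ?R :: rat poly) = 0 \<or> degree (map_poly of_int Q :: rat poly) = 0"
      by (auto dest: poly_dvd_1[THEN iffD1])
    then show False using assms by simp
  qed
  moreover have "\<alpha> \<in> complex_roots (?R * Q)" "\<beta> \<in> complex_roots (?R * Q)"
    using assms unfolding complex_roots_mult by auto
  ultimately show ?thesis using assms(6) unfolding monic_reducible_polys_def by blast
qed

text \<open>\<open>Q k\<close> takes the nonzero value \<open>q k\<close> at the root
  \<open>\<beta> k\<close> of the quadratic factor, so \<open>ex_root_near\<close> yields another
  root at distance at most \<open>n * \<bar>q k\<bar> / \<bar>q' k\<bar>\<close>. Meanwhile
  \<open>h k\<close> bounds the height of the product from above, and \<open>const\<close> drives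
  the heights to infinity through the constant coefficient.\<close>

lemma e_r_star_ge:
  fixes Q :: "nat \<Rightarrow> int poly" and u v A :: "nat \<Rightarrow> int" and \<beta> q q' h :: "nat \<Rightarrow> real"
  assumes n: "n \<ge> 1" and L: "L > 0"
    and Q: "\<And>k. lead_coeff (Q k) = 1" "\<And>k. degree (Q k) = n"
    and R: "\<forall>\<^sub>F k in sequentially. poly (map_poly of_int [:v k, u k, 1:]) (\<beta> k) = 0"
    and q: "\<forall>\<^sub>F k in sequentially. poly (map_poly of_int (Q k)) (\<beta> k) = q k"
    and q0: "\<forall>\<^sub>F k in sequentially. q k \<noteq> 0"
    and q': "\<And>k. poly (map_poly of_int (pderiv (Q k))) (\<beta> k) = q' k"
    and q'0: "\<forall>\<^sub>F k in sequentially. q' k \<noteq> 0"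
    and A: "\<forall>\<^sub>F k in sequentially. \<forall>i. \<bar>coeff (Q k) i\<bar> \<le> A k"
    and h: "\<forall>\<^sub>F k in sequentially. real_of_int ((\<bar>v k\<bar> + \<bar>u k\<bar> + 1) * A k) \<le> h k"
    and const: "\<And>k. int k \<le> \<bar>v k * coeff (Q k) 0\<bar>"
    and lim: "(\<lambda>k. - ln (real n * \<bar>q k\<bar> / \<bar>q' k\<bar>) / ln (h k)) \<longlonglongrightarrow> L"
  shows "ereal L \<le> e_r_star (n + 2)"
proof -
  define P where "P k = [:v k, u k, 1:] * Q k" for k
  define e where "e k = - ln (real n * \<bar>q k\<bar> / \<bar>q' k\<bar>) / ln (h k)" for k
  have P0: "P k \<noteq> 0" for k
  proof -
    have "Q k \<noteq> 0" using Q(1)[of k] by auto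
    then show ?thesis unfolding P_def by (simp del: mult_pCons_left)
  qed
  have tall: "\<forall>\<^sub>F k in sequentially. height (P k) \<ge> H" for H
    using eventually_ge_at_top[of "nat H"]
  proof eventually_elim
    case (elim k)
    have "height (P k) \<ge> int k"
      using abs_coeff_le_height[OF P0, of k 0] const[of k] by (simp add: P_def)
    then show ?case using elim by linarith
  qed
  have epos: "\<forall>\<^sub>F k in sequentially. e k > 0"
    using lim L unfolding e_def by (rule order_tendstoD)
  have main: "\<forall>\<^sub>F k in sequentially. P k \<in> monic_reducible_polys (n + 2) \<and> e k \<le> sep_exponent (P k)"
    using R q q0 q'0 A h tall[of 2] epos
  proof eventually_elim
    case (elim k)
    let ?b = "complex_of_real (\<beta> k)" and ?\<delta> = "real n * \<bar>q k\<bar> / \<bar>q' k\<bar>"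
    have "poly (map_poly of_int (pderiv (Q k))) ?b \<noteq> 0"
      unfolding poly_of_int_of_real q' using elim by simp
    from ex_root_near[OF Q(1) this] obtain a where a: "a \<in> complex_roots (Q k)"
      and near: "cmod (?b - a) \<le> ?\<delta>"
      using elim unfolding poly_of_int_of_real q' Q(2) by auto
    have b: "?b \<in> complex_roots [:v k, u k, 1:]"
      using elim unfolding complex_roots_def mem_Collect_eq poly_of_int_of_real by simp
    \<comment> \<open>\<open>Q k\<close> vanishes at \<open>a\<close> but not at \<open>?b\<close>,
      since \<open>q k\<close> is nonzero.\<close>
    have ne: "a \<noteq> ?b" using a elim by (auto simp: complex_roots_def poly_of_int_of_real)
    have mem: "P k \<in> monic_reducible_polys (n + 2)"
      unfolding P_def by (rule mult_quadratic_in_monic_reducible_polys[OF Q n a b ne])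
    have roots: "a \<in> complex_roots (P k)" "?b \<in> complex_roots (P k)"
      using a b unfolding P_def complex_roots_mult by auto
    obtain \<gamma> \<delta>' where "\<gamma> \<noteq> \<delta>'" "root_sep (P k) = cmod (\<gamma> - \<delta>')"
      using root_sep_attained[OF P0 roots ne] .
    then have sep0: "root_sep (P k) > 0" by simp
    have "root_sep (P k) \<le> cmod (?b - a)" using root_sep_le[OF P0 roots(2,1)] ne by auto
    also note near
    finally have sep: "ln (root_sep (P k)) \<le> ln ?\<delta>" using sep0 by simp
    have H2: "real_of_int (height (P k)) \<ge> 2" using elim by linarith
    have "height (P k) \<le> (\<bar>v k\<bar> + \<bar>u k\<bar> + 1) * A k"
      unfolding P_def by (rule height_mult_quadratic_le) (use elim in blast)
    then have "real_of_int (height (P k)) \<le> h k" using elim by linarith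
    then have lnh: "0 < ln (real_of_int (height (P k)))" "ln (real_of_int (height (P k))) \<le> ln (h k)"
      using H2 by auto
    have "ln (h k) > 0" using lnh by linarith
    \<comment> \<open>A positive numerator is needed so that replacing \<open>ln (h k)\<close> by
      the smaller logarithm of the height increases the quotient; it comes from
      \<open>L > 0\<close>.\<close>
    with elim have "- ln ?\<delta> > 0" unfolding e_def zero_less_divide_iff by linarith
    then have "e k \<le> - ln ?\<delta> / ln (real_of_int (height (P k)))"
      unfolding e_def using lnh by (intro divide_left_mono) auto
    also have "\<dots> \<le> sep_exponent (P k)"
      unfolding sep_exponent_def using lnh sep by (intro divide_right_mono) auto
    finally show ?case using mem by blast
  qed
  show ?thesis unfolding e_r_star_eq_INF
  proof (rule INF_greatest)
    fix H :: int
    let ?S = "SUP P\<in>{P \<in> monic_reducible_polys (n + 2). H \<le> height P}. ereal (sep_exponent P)"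
    have "\<forall>\<^sub>F k in sequentially. ereal (e k) \<le> ?S"
      using main tall[of H]
    proof eventually_elim
      case (elim k)
      then have "ereal (sep_exponent (P k)) \<le> ?S" by (intro SUP_upper) auto
      then show ?case using elim by (meson ereal_less_eq(3) order_trans)
    qed
    moreover have "(\<lambda>k. ereal (e k)) \<longlonglongrightarrow> ereal L"
      using lim unfolding e_def by (rule tendsto_ereal)
    ultimately show "ereal L \<le> ?S" by (intro tendsto_upperbound) auto
  qed
qed

section \<open>The small quadratic unit\<close>

text \<open>For \<open>t \<ge> 2\<close> this is the smaller root (t - sqrt(t^2 - 4)) / 2 of y^2 - t
  y + 1, rationalised so that positivity and the order 1/t are visible.\<close>

definition small_unit :: "real \<Rightarrow> real" where
  "small_unit t = 2 / (t + sqrt (t ^ 2 - 4))"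

lemma small_unit:
  assumes "t \<ge> 2"
  shows "small_unit t > 0" "t * small_unit t = 1 + small_unit t ^ 2"
proof -
  define s where "s = sqrt (t ^ 2 - 4)"
  define d where "d = t + s"
  have "t ^ 2 \<ge> 2 ^ 2" using assms by (intro power_mono) auto
  then have s: "s \<ge> 0" "s ^ 2 = t ^ 2 - 4" unfolding s_def by auto
  have pos: "d > 0" using s assms by (simp add: d_def)
  have eq: "small_unit t = 2 / d" unfolding small_unit_def s_def[symmetric] d_def ..
  show "small_unit t > 0" unfolding eq using pos by simp
  have "t * (2 / d) = (t * 2 * d) / d ^ 2" using pos by (simp add: power2_eq_square)
  also have "t * 2 * d = d ^ 2 + 4" unfolding d_def using s(2) by (simp add: power2_eq_square algebra_simps)
  also have "(d ^ 2 + 4) / d ^ 2 = 1 + (2 / d) ^ 2" using pos by (simp add: add_divide_distrib power_divide)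
  finally show "t * small_unit t = 1 + small_unit t ^ 2" unfolding eq .
qed

lemma eventually_small_unit:
  "\<forall>\<^sub>F k in sequentially. real k * small_unit (real k) = 1 + small_unit (real k) ^ 2 \<and> small_unit (real k) \<noteq> 0"
  using eventually_ge_at_top[of 2]
proof eventually_elim
  case (elim k)
  then show ?case using small_unit[of "real k"] by simp
qed

section \<open>The family of degree 5 (n = 2)\<close>

text \<open>The method name is qualified because HOL-Algebra has a different method \<open>algebra\<close>.\<close>

lemma quadratic_root_5:
  fixes t y :: real
  assumes ty: "t * y = 1 + y ^ 2" and y: "y \<noteq> 0"
  defines "b \<equiv> y ^ 2 + y"
  shows "t + 2 - (- 2 + t + t ^ 2) * b + b ^ 2 = 0"
proof -
  have ty2: "t ^ 2 * y ^ 2 = (1 + y ^ 2) ^ 2"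
    unfolding power_mult_distrib[symmetric] ty ..
  \<comment> \<open>The conjugates y^2 + y and y^(-2) + y^(-1) have product t + 2 and sum t^2 + t -
    2. Multiplying by y^2 pairs every t with a y, and replacing \<open>t * y\<close> by
    \<open>1 + y ^ 2\<close> leaves an identity in y alone.\<close>
  have "y ^ 2 * (t + 2 - (- 2 + t + t ^ 2) * b + b ^ 2)
    = (t * y) * y + 2 * y ^ 2 - (- 2 * y ^ 2 + (t * y) * y + (t ^ 2 * y ^ 2)) * b + y ^ 2 * b ^ 2"
    by Groebner_Basis.algebra
  also have "\<dots> = 0" unfolding ty ty2 b_def by Groebner_Basis.algebra
  finally show ?thesis using y by simp
qed

text \<open>The left-hand side is Q(b) in Horner form. Its coefficients are linear in t, so one
  factor y suffices to eliminate t. The exponent is n (2n - 1) for n = 2.\<close>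

lemma unit_value_5:
  fixes t y :: real
  assumes ty: "t * y = 1 + y ^ 2" and y: "y \<noteq> 0"
  defines "b \<equiv> y ^ 2 + y"
  shows "1 + b * (4 - t + b * (3 - 3 * t + b)) = y ^ 6"
proof -
  have "y * (1 + b * (4 - t + b * (3 - 3 * t + b)))
    = y + b * (4 * y - (t * y) + b * (3 * y - 3 * (t * y) + b * y))"
    by Groebner_Basis.algebra
  also have "\<dots> = y * y ^ 6"
    unfolding ty b_def by Groebner_Basis.algebra
  finally have "y * (1 + b * (4 - t + b * (3 - 3 * t + b)))
    = y * y ^ 6" .
  moreover have "y \<noteq> 0" using y by simp
  ultimately show ?thesis by (metis mult_left_cancel)
qed

text \<open>For t = k the value of Q has order t^(-6) and its derivative order t, so the distance is
  at most of order t^(-7), against a height of order at most t^3.\<close>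

lemma e_r_star_5_ge: "ereal (7 / 3) \<le> e_r_star 5"
proof -
  define y where "y k = small_unit (real k)" for k :: nat
  define \<beta> where "\<beta> k = y k ^ 2 + y k" for k
  \<comment> \<open>The derivative of Q at the root in Horner form; its dominant term is -k, as
    \<open>\<beta> k\<close> has order 1/k.\<close>
  define D where "D k = 4 - real k + \<beta> k * (6 - 6 * real k + \<beta> k * 3)" for k
  define Q where "Q k = [:1, 4 - int k, 3 - 3 * int k, 1:]" for k
  have y: "\<forall>\<^sub>F k in sequentially. real k * y k = 1 + y k ^ 2 \<and> y k \<noteq> 0"
    unfolding y_def by (rule eventually_small_unit)
  have "ereal (7 / 3) \<le> e_r_star (3 + 2)"
  proof (rule e_r_star_ge)
    show "lead_coeff (Q k) = 1" "degree (Q k) = 3" for k by (simp_all add: Q_def)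
    show "\<forall>\<^sub>F k in sequentially. poly (map_poly of_int [:int k + 2, - (- 2 + int k + int k ^ 2), 1:]) (\<beta> k) = 0"
      using y
    proof eventually_elim
      case (elim k)
      with quadratic_root_5[of "real k" "y k"] show ?case
        unfolding \<beta>_def[symmetric] by (simp add: algebra_simps power2_eq_square)
    qed
    show "\<forall>\<^sub>F k in sequentially. poly (map_poly of_int (Q k)) (\<beta> k) = y k ^ 6"
      using y
    proof eventually_elim
      case (elim k)
      with unit_value_5[of "real k" "y k"] show ?case
        unfolding \<beta>_def[symmetric] by (simp add: Q_def)
    qed
    show "\<forall>\<^sub>F k in sequentially. y k ^ 6 \<noteq> 0"
      using y by eventually_elim simp
    show "poly (map_poly of_int (pderiv (Q k))) (\<beta> k) = D k" for k
      by (simp add: Q_def D_def pderiv_pCons of_int_poly_hom.hom_numeral algebra_simps)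
    have "\<forall>\<^sub>F k in sequentially. D k < 0"
      unfolding D_def \<beta>_def y_def small_unit_def by real_asymp
    then show "\<forall>\<^sub>F k in sequentially. D k \<noteq> 0"
      by (rule eventually_mono) simp
    \<comment> \<open>The constant is 3 + 3, from the coefficient
      \<open>3 - 3 * int k\<close>.\<close>
    show "\<forall>\<^sub>F k in sequentially. \<forall>i. \<bar>coeff (Q k) i\<bar> \<le> 6 * int k"
      using eventually_ge_at_top[of 1]
    proof eventually_elim
      case (elim k)
      define t where "t = int k"
      have "1 \<le> t" using elim by (simp add: t_def)
      moreover from this have "t \<le> t ^ 2" "t ^ 2 \<le> t ^ 3"
        by (auto intro: self_le_power power_increasing)
      ultimately show ?case
        unfolding Q_def t_def[symmetric] by (auto simp: coeff_pCons abs_le_iff split: nat.split)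
    qed
    \<comment> \<open>Only the power of k matters; the generous constant disappears in the quotient
      of logarithms.\<close>
    show "\<forall>\<^sub>F k in sequentially.
      real_of_int ((\<bar>int k + 2\<bar> + \<bar>- (- 2 + int k + int k ^ 2)\<bar> + 1) * (6 * int k)) \<le> 100000 * real k ^ 3"
      by simp real_asymp
    show "int k \<le> \<bar>(int k + 2) * coeff (Q k) 0\<bar>" for k by (simp add: Q_def)
    show "(\<lambda>k. - ln (real 3 * \<bar>y k ^ 6\<bar> / \<bar>D k\<bar>) / ln (100000 * real k ^ 3)) \<longlonglongrightarrow> 7 / 3"
      unfolding D_def \<beta>_def y_def small_unit_def by real_asymp
  qed simp_all
  then show ?thesis by simp
qed

section \<open>The family of degree 7 (n = 3)\<close>

text \<open>The conjugates y^3 + y^2 and y^(-3) + y^(-2) have product t + 2 and sum (t^3 - 3t) +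
  (t^2 - 2).\<close>

lemma quadratic_root_7:
  fixes t y :: real
  assumes ty: "t * y = 1 + y ^ 2" and y: "y \<noteq> 0"
  defines "b \<equiv> y ^ 3 + y ^ 2"
  shows "t + 2 - (- 2 - 3 * t + t ^ 2 + t ^ 3) * b + b ^ 2 = 0"
proof -
  have ty2: "t ^ 2 * y ^ 2 = (1 + y ^ 2) ^ 2"
    unfolding power_mult_distrib[symmetric] ty ..
  have ty3: "t ^ 3 * y ^ 3 = (1 + y ^ 2) ^ 3"
    unfolding power_mult_distrib[symmetric] ty ..
  have "y ^ 3 * (t + 2 - (- 2 - 3 * t + t ^ 2 + t ^ 3) * b + b ^ 2)
    = (t * y) * y ^ 2 + 2 * y ^ 3 - (- 2 * y ^ 3 - 3 * (t * y) * y ^ 2 + (t ^ 2 * y ^ 2) * y + (t ^ 3 * y ^ 3)) * b + y ^ 3 * b ^ 2"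
    by Groebner_Basis.algebra
  also have "\<dots> = 0" unfolding ty ty2 ty3 b_def by Groebner_Basis.algebra
  finally show ?thesis using y by simp
qed

text \<open>The coefficients of Q are quadratic in t, so y^2 eliminates t; the exponent is 3 *
  5.\<close>

lemma unit_value_7:
  fixes t y :: real
  assumes ty: "t * y = 1 + y ^ 2" and y: "y \<noteq> 0"
  defines "b \<equiv> y ^ 3 + y ^ 2"
  shows "- 1 + b * (9 - t + t ^ 2 + b * (- 15 + 10 * t - 10 * t ^ 2
    + b * (- 17 - 26 * t + 25 * t ^ 2 + b * (- 10 + 10 * t - 5 * t ^ 2 + b)))) = y ^ 15"
proof -
  have ty2: "t ^ 2 * y ^ 2 = (1 + y ^ 2) ^ 2"
    unfolding power_mult_distrib[symmetric] ty ..
  have "y ^ 2 * (- 1 + b * (9 - t + t ^ 2 + b * (- 15 + 10 * t - 10 * t ^ 2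
    + b * (- 17 - 26 * t + 25 * t ^ 2 + b * (- 10 + 10 * t - 5 * t ^ 2 + b)))))
    = - (y ^ 2) + b * (9 * y ^ 2 - (t * y) * y + (t ^ 2 * y ^ 2)
    + b * (- 15 * y ^ 2 + 10 * (t * y) * y - 10 * (t ^ 2 * y ^ 2)
    + b * (- 17 * y ^ 2 - 26 * (t * y) * y + 25 * (t ^ 2 * y ^ 2)
    + b * (- 10 * y ^ 2 + 10 * (t * y) * y - 5 * (t ^ 2 * y ^ 2) + b * y ^ 2))))"
    by Groebner_Basis.algebra
  also have "\<dots> = y ^ 2 * y ^ 15"
    unfolding ty ty2 b_def by Groebner_Basis.algebra
  finally have "y ^ 2 * (- 1 + b * (9 - t + t ^ 2 + b * (- 15 + 10 * t - 10 * t ^ 2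
    + b * (- 17 - 26 * t + 25 * t ^ 2 + b * (- 10 + 10 * t - 5 * t ^ 2 + b)))))
    = y ^ 2 * y ^ 15" .
  moreover have "y ^ 2 \<noteq> 0" using y by simp
  ultimately show ?thesis by (metis mult_left_cancel)
qed

text \<open>The value has order t^(-15) and the derivative order t^2, so the distance is at most of
  order t^(-17), against a height of order at most t^5.\<close>

lemma e_r_star_7_ge: "ereal (17 / 5) \<le> e_r_star 7"
proof -
  define y where "y k = small_unit (real k)" for k :: nat
  define \<beta> where "\<beta> k = y k ^ 3 + y k ^ 2" for k
  define D where "D k = 9 - real k + real k ^ 2 + \<beta> k * (- 30 + 20 * real k - 20 * real k ^ 2
      + \<beta> k * (- 51 - 78 * real k + 75 * real k ^ 2
      + \<beta> k * (- 40 + 40 * real k - 20 * real k ^ 2 + \<beta> k * 5)))" for k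
  define Q where "Q k = [:- 1, 9 - int k + int k ^ 2, - 15 + 10 * int k - 10 * int k ^ 2, - 17 - 26 * int k + 25 * int k ^ 2, - 10 + 10 * int k - 5 * int k ^ 2, 1:]" for k
  have y: "\<forall>\<^sub>F k in sequentially. real k * y k = 1 + y k ^ 2 \<and> y k \<noteq> 0"
    unfolding y_def by (rule eventually_small_unit)
  have "ereal (17 / 5) \<le> e_r_star (5 + 2)"
  proof (rule e_r_star_ge)
    show "lead_coeff (Q k) = 1" "degree (Q k) = 5" for k by (simp_all add: Q_def)
    show "\<forall>\<^sub>F k in sequentially. poly (map_poly of_int [:int k + 2, - (- 2 - 3 * int k + int k ^ 2 + int k ^ 3), 1:]) (\<beta> k) = 0"
      using y
    proof eventually_elim
      case (elim k)
      with quadratic_root_7[of "real k" "y k"] show ?case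
        unfolding \<beta>_def[symmetric] by (simp add: algebra_simps power2_eq_square)
    qed
    show "\<forall>\<^sub>F k in sequentially. poly (map_poly of_int (Q k)) (\<beta> k) = y k ^ 15"
      using y
    proof eventually_elim
      case (elim k)
      with unit_value_7[of "real k" "y k"] show ?case
        unfolding \<beta>_def[symmetric] by (simp add: Q_def)
    qed
    show "\<forall>\<^sub>F k in sequentially. y k ^ 15 \<noteq> 0"
      using y by eventually_elim simp
    show "poly (map_poly of_int (pderiv (Q k))) (\<beta> k) = D k" for k
      by (simp add: Q_def D_def pderiv_pCons of_int_poly_hom.hom_numeral algebra_simps)
    have "\<forall>\<^sub>F k in sequentially. D k > 0"
      unfolding D_def \<beta>_def y_def small_unit_def by real_asymp
    then show "\<forall>\<^sub>F k in sequentially. D k \<noteq> 0"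
      by (rule eventually_mono) simp
    \<comment> \<open>The constant is 17 + 26 + 25, from the cubic coefficient of
      \<open>Q k\<close>.\<close>
    show "\<forall>\<^sub>F k in sequentially. \<forall>i. \<bar>coeff (Q k) i\<bar> \<le> 68 * int k ^ 2"
      using eventually_ge_at_top[of 1]
    proof eventually_elim
      case (elim k)
      define t where "t = int k"
      have "1 \<le> t" using elim by (simp add: t_def)
      moreover from this have "t \<le> t ^ 2" "t ^ 2 \<le> t ^ 3"
        by (auto intro: self_le_power power_increasing)
      ultimately show ?case
        unfolding Q_def t_def[symmetric] by (auto simp: coeff_pCons abs_le_iff split: nat.split)
    qed
    show "\<forall>\<^sub>F k in sequentially.
      real_of_int ((\<bar>int k + 2\<bar> + \<bar>- (- 2 - 3 * int k + int k ^ 2 + int k ^ 3)\<bar> + 1) * (68 * int k ^ 2)) \<le> 100000 * real k ^ 5"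
      by simp real_asymp
    show "int k \<le> \<bar>(int k + 2) * coeff (Q k) 0\<bar>" for k by (simp add: Q_def)
    show "(\<lambda>k. - ln (real 5 * \<bar>y k ^ 15\<bar> / \<bar>D k\<bar>) / ln (100000 * real k ^ 5)) \<longlonglongrightarrow> 17 / 5"
      unfolding D_def \<beta>_def y_def small_unit_def by real_asymp
  qed simp_all
  then show ?thesis by simp
qed

section \<open>The family of degree 9 (n = 4)\<close>

text \<open>The conjugates y^4 + y^3 and y^(-4) + y^(-3) have product t + 2 and sum (t^4 - 4t^2 + 2)
  + (t^3 - 3t).\<close>

lemma quadratic_root_9:
  fixes t y :: real
  assumes ty: "t * y = 1 + y ^ 2" and y: "y \<noteq> 0"
  defines "b \<equiv> y ^ 4 + y ^ 3"
  shows "t + 2 - (2 - 3 * t - 4 * t ^ 2 + t ^ 3 + t ^ 4) * b + b ^ 2 = 0"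
proof -
  have ty2: "t ^ 2 * y ^ 2 = (1 + y ^ 2) ^ 2"
    unfolding power_mult_distrib[symmetric] ty ..
  have ty3: "t ^ 3 * y ^ 3 = (1 + y ^ 2) ^ 3"
    unfolding power_mult_distrib[symmetric] ty ..
  have ty4: "t ^ 4 * y ^ 4 = (1 + y ^ 2) ^ 4"
    unfolding power_mult_distrib[symmetric] ty ..
  have "y ^ 4 * (t + 2 - (2 - 3 * t - 4 * t ^ 2 + t ^ 3 + t ^ 4) * b + b ^ 2)
    = (t * y) * y ^ 3 + 2 * y ^ 4 - (2 * y ^ 4 - 3 * (t * y) * y ^ 3 - 4 * (t ^ 2 * y ^ 2) * y ^ 2 + (t ^ 3 * y ^ 3) * y + (t ^ 4 * y ^ 4)) * b + y ^ 4 * b ^ 2"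
    by Groebner_Basis.algebra
  also have "\<dots> = 0" unfolding ty ty2 ty3 ty4 b_def by Groebner_Basis.algebra
  finally show ?thesis using y by simp
qed

text \<open>The coefficients of Q are cubic in t, so y^3 eliminates t; the exponent is 4 *
  7.\<close>

lemma unit_value_9:
  fixes t y :: real
  assumes ty: "t * y = 1 + y ^ 2" and y: "y \<noteq> 0"
  defines "b \<equiv> y ^ 4 + y ^ 3"
  shows "1 + b * (20 + 2 * t + t ^ 2 - t ^ 3 + b * (126 + 42 * t + 21 * t ^ 2 - 21 * t ^ 3
    + b * (228 + 291 * t + 148 * t ^ 2 - 147 * t ^ 3
    + b * (- 119 + 700 * t + 385 * t ^ 2 - 371 * t ^ 3
    + b * (12 + 244 * t + 245 * t ^ 2 - 196 * t ^ 3
    + b * (84 - 35 * t + 21 * t ^ 2 - 7 * t ^ 3 + b)))))) = y ^ 28"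
proof -
  have ty2: "t ^ 2 * y ^ 2 = (1 + y ^ 2) ^ 2"
    unfolding power_mult_distrib[symmetric] ty ..
  have ty3: "t ^ 3 * y ^ 3 = (1 + y ^ 2) ^ 3"
    unfolding power_mult_distrib[symmetric] ty ..
  have "y ^ 3 * (1 + b * (20 + 2 * t + t ^ 2 - t ^ 3 + b * (126 + 42 * t + 21 * t ^ 2 - 21 * t ^ 3
    + b * (228 + 291 * t + 148 * t ^ 2 - 147 * t ^ 3
    + b * (- 119 + 700 * t + 385 * t ^ 2 - 371 * t ^ 3
    + b * (12 + 244 * t + 245 * t ^ 2 - 196 * t ^ 3
    + b * (84 - 35 * t + 21 * t ^ 2 - 7 * t ^ 3 + b)))))))
    = y ^ 3 + b * (20 * y ^ 3 + 2 * (t * y) * y ^ 2 + (t ^ 2 * y ^ 2) * y - (t ^ 3 * y ^ 3)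
    + b * (126 * y ^ 3 + 42 * (t * y) * y ^ 2 + 21 * (t ^ 2 * y ^ 2) * y - 21 * (t ^ 3 * y ^ 3)
    + b * (228 * y ^ 3 + 291 * (t * y) * y ^ 2 + 148 * (t ^ 2 * y ^ 2) * y - 147 * (t ^ 3 * y ^ 3)
    + b * (- 119 * y ^ 3 + 700 * (t * y) * y ^ 2 + 385 * (t ^ 2 * y ^ 2) * y - 371 * (t ^ 3 * y ^ 3)
    + b * (12 * y ^ 3 + 244 * (t * y) * y ^ 2 + 245 * (t ^ 2 * y ^ 2) * y - 196 * (t ^ 3 * y ^ 3)
    + b * (84 * y ^ 3 - 35 * (t * y) * y ^ 2 + 21 * (t ^ 2 * y ^ 2) * y - 7 * (t ^ 3 * y ^ 3) + b * y ^ 3))))))"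
    by Groebner_Basis.algebra
  also have "\<dots> = y ^ 3 * y ^ 28"
    unfolding ty ty2 ty3 b_def by Groebner_Basis.algebra
  finally have "y ^ 3 * (1 + b * (20 + 2 * t + t ^ 2 - t ^ 3 + b * (126 + 42 * t + 21 * t ^ 2 - 21 * t ^ 3
    + b * (228 + 291 * t + 148 * t ^ 2 - 147 * t ^ 3
    + b * (- 119 + 700 * t + 385 * t ^ 2 - 371 * t ^ 3
    + b * (12 + 244 * t + 245 * t ^ 2 - 196 * t ^ 3
    + b * (84 - 35 * t + 21 * t ^ 2 - 7 * t ^ 3 + b)))))))
    = y ^ 3 * y ^ 28" .
  moreover have "y ^ 3 \<noteq> 0" using y by simp
  ultimately show ?thesis by (metis mult_left_cancel)
qed

text \<open>The value has order t^(-28) and the derivative order t^3, so the distance is at most of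
  order t^(-31), against a height of order at most t^7.\<close>

lemma e_r_star_9_ge: "ereal (31 / 7) \<le> e_r_star 9"
proof -
  define y where "y k = small_unit (real k)" for k :: nat
  define \<beta> where "\<beta> k = y k ^ 4 + y k ^ 3" for k
  define D where "D k = 20 + 2 * real k + real k ^ 2 - real k ^ 3
      + \<beta> k * (252 + 84 * real k + 42 * real k ^ 2 - 42 * real k ^ 3
      + \<beta> k * (684 + 873 * real k + 444 * real k ^ 2 - 441 * real k ^ 3
      + \<beta> k * (- 476 + 2800 * real k + 1540 * real k ^ 2 - 1484 * real k ^ 3
      + \<beta> k * (60 + 1220 * real k + 1225 * real k ^ 2 - 980 * real k ^ 3
      + \<beta> k * (504 - 210 * real k + 126 * real k ^ 2 - 42 * real k ^ 3 + \<beta> k * 7)))))" for k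
  define Q where "Q k = [:1, 20 + 2 * int k + int k ^ 2 - int k ^ 3, 126 + 42 * int k + 21 * int k ^ 2 - 21 * int k ^ 3, 228 + 291 * int k + 148 * int k ^ 2 - 147 * int k ^ 3, - 119 + 700 * int k + 385 * int k ^ 2 - 371 * int k ^ 3, 12 + 244 * int k + 245 * int k ^ 2 - 196 * int k ^ 3, 84 - 35 * int k + 21 * int k ^ 2 - 7 * int k ^ 3, 1:]" for k
  have y: "\<forall>\<^sub>F k in sequentially. real k * y k = 1 + y k ^ 2 \<and> y k \<noteq> 0"
    unfolding y_def by (rule eventually_small_unit)
  have "ereal (31 / 7) \<le> e_r_star (7 + 2)"
  proof (rule e_r_star_ge)
    show "lead_coeff (Q k) = 1" "degree (Q k) = 7" for k by (simp_all add: Q_def)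
    show "\<forall>\<^sub>F k in sequentially. poly (map_poly of_int [:int k + 2, - (2 - 3 * int k - 4 * int k ^ 2 + int k ^ 3 + int k ^ 4), 1:]) (\<beta> k) = 0"
      using y
    proof eventually_elim
      case (elim k)
      with quadratic_root_9[of "real k" "y k"] show ?case
        unfolding \<beta>_def[symmetric] by (simp add: algebra_simps power2_eq_square)
    qed
    show "\<forall>\<^sub>F k in sequentially. poly (map_poly of_int (Q k)) (\<beta> k) = y k ^ 28"
      using y
    proof eventually_elim
      case (elim k)
      with unit_value_9[of "real k" "y k"] show ?case
        unfolding \<beta>_def[symmetric] by (simp add: Q_def)
    qed
    show "\<forall>\<^sub>F k in sequentially. y k ^ 28 \<noteq> 0"
      using y by eventually_elim simp
    show "poly (map_poly of_int (pderiv (Q k))) (\<beta> k) = D k" for k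
      by (simp add: Q_def D_def pderiv_pCons of_int_poly_hom.hom_numeral algebra_simps)
    have "\<forall>\<^sub>F k in sequentially. D k < 0"
      unfolding D_def \<beta>_def y_def small_unit_def by real_asymp
    then show "\<forall>\<^sub>F k in sequentially. D k \<noteq> 0"
      by (rule eventually_mono) simp
    \<comment> \<open>The constant is 119 + 700 + 385 + 371, from the quartic coefficient of
      \<open>Q k\<close>.\<close>
    show "\<forall>\<^sub>F k in sequentially. \<forall>i. \<bar>coeff (Q k) i\<bar> \<le> 1575 * int k ^ 3"
      using eventually_ge_at_top[of 1]
    proof eventually_elim
      case (elim k)
      define t where "t = int k"
      have "1 \<le> t" using elim by (simp add: t_def)
      moreover from this have "t \<le> t ^ 2" "t ^ 2 \<le> t ^ 3"
        by (auto intro: self_le_power power_increasing)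
      ultimately show ?case
        unfolding Q_def t_def[symmetric] by (auto simp: coeff_pCons abs_le_iff split: nat.split)
    qed
    show "\<forall>\<^sub>F k in sequentially.
      real_of_int ((\<bar>int k + 2\<bar> + \<bar>- (2 - 3 * int k - 4 * int k ^ 2 + int k ^ 3 + int k ^ 4)\<bar> + 1) * (1575 * int k ^ 3)) \<le> 100000 * real k ^ 7"
      by simp real_asymp
    show "int k \<le> \<bar>(int k + 2) * coeff (Q k) 0\<bar>" for k by (simp add: Q_def)
    show "(\<lambda>k. - ln (real 7 * \<bar>y k ^ 28\<bar> / \<bar>D k\<bar>) / ln (100000 * real k ^ 7)) \<longlonglongrightarrow> 31 / 7"
      unfolding D_def \<beta>_def y_def small_unit_def by real_asymp
  qed simp_all
  then show ?thesis by simp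
qed

theorem corollary1:
  "ereal (7/3) \<le> e_r_star 5 \<and> e_r_star 5 \<le> ereal 3 \<and>
   ereal (17/5) \<le> e_r_star 7 \<and> e_r_star 7 \<le> ereal 5 \<and>
   ereal (31/7) \<le> e_r_star 9 \<and> e_r_star 9 \<le> ereal 7"
  using e_r_star_5_ge e_r_star_7_ge e_r_star_9_ge e_r_star_le[of 5] e_r_star_le[of 7] e_r_star_le[of 9]
  by simp

end
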